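(* Let $\alpha,\beta,\gamma,a,b,c,z,s\in\mathbb{C}$ with $\mathrm{Re}(\alpha)>0$, $\mathrm{Re}(c)>\mathrm{Re}(b)>0$, $\mathrm{Re}(s)>0$ and $|z|<1$. Then the Mellin transform in $p$ of the ML-generalized Gauss hypergeometric function is $$\mathfrak{M}\left[{}^{ML}F_{p}(a,b;c;z):s\right]=\int_0^\infty p^{s-1}\;{}^{ML}F_{p}(a,b;c;z)\,dp=\frac{{}^{ML}\Gamma(s)\,B(b+s,c+s-b)}{B(b,c-b)}\;{}_{2}F_{1}(a,b+s;c+2s;z).$$
   Context: The three-parameter Mittag-Leffler function is $E_{\alpha,\beta}^{\gamma}(z)=\sum_{n=0}^{\infty}\frac{(\gamma)_n}{\Gamma(\alpha n+\beta)}\frac{z^n}{n!}$ for $\alpha,\beta,\gamma\in\mathbb{C}$, $\mathrm{Re}(\alpha)>0$, where $(\gamma)_n=\gamma(\gamma+1)\cdots(\gamma+n-1)$, $(\gamma)_0=1$. The ML-generalized beta function is ${}^{ML}B_{p}(x,y)=\int_{0}^{1}t^{x-1}(1-t)^{y-1}E_{\alpha,\beta}^{\gamma}\left(-\frac{p}{t(1-t)}\right)dt$ for $\mathrm{Re}(x)>0$, $\mathrm{Re}(y)>0$ (the parameters $\alpha,\beta,\gamma$ are suppressed in the notation), ${}^{ML}\Gamma(s)=\int_0^\infty u^{s-1}E_{\alpha,\beta}^{\gamma}(-u)\,du$, and $B(x,y)=\int_0^1 t^{x-1}(1-t)^{y-1}dt$ is the classical beta function. The ML-generalized Gauss hypergeometric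 function is ${}^{ML}F_{p}(a,b;c;z)=\sum_{n=0}^{\infty}(a)_n\frac{{}^{ML}B_{p}(b+n,c-b)}{B(b,c-b)}\frac{z^n}{n!}$ for $p\ge 0$, $|z|<1$, $\mathrm{Re}(c)>\mathrm{Re}(b)>0$, $\mathrm{Re}(\alpha)>0$. The classical Gauss function is ${}_2F_1(a,b;c;z)=\sum_{n=0}^\infty\frac{(a)_n(b)_n}{(c)_n}\frac{z^n}{n!}$.
   Formalization: The formal theorem additionally assumes that the integral defining ML-Γ(s) converges (conditional convergence suffices); without this the right-hand side is undefined, e.g. for α=β=1, γ=1/2, s=1. *)

theory Defs
  imports "HOL-Analysis.Analysis"
begin

text \<open>
  All integrals are Henstock--Kurzweil integrals, so they cover both Lebesgue integrals and
  improper integrals that converge only conditionally. The classical beta function is the library's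
  \<^const>\<open>Beta\<close>.
\<close>

text \<open>
  Three-parameter Mittag-Leffler function. Writing \<^const>\<open>rGamma\<close> for the reciprocal of
  \<^const>\<open>Gamma\<close> makes the usual convention explicit that a coefficient vanishes whenever
  \<open>\<alpha> * n + \<beta>\<close> is a pole of \<^const>\<open>Gamma\<close>.
\<close>
definition mittag_leffler :: "complex \<Rightarrow> complex \<Rightarrow> complex \<Rightarrow> complex \<Rightarrow> complex" where
  "mittag_leffler \<alpha> \<beta> \<gamma> z =
     (\<Sum>n. pochhammer \<gamma> n * rGamma (\<alpha> * of_nat n + \<beta>) * z ^ n / fact n)"

definition mittag_leffler_Gamma :: "complex \<Rightarrow> complex \<Rightarrow> complex \<Rightarrow> complex \<Rightarrow> complex" where
  "mittag_leffler_Gamma \<alpha> \<beta> \<gamma> s =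
     integral {0..} (\<lambda>u. of_real u powr (s - 1) * mittag_leffler \<alpha> \<beta> \<gamma> (of_real (- u)))"

definition mittag_leffler_Beta ::
    "complex \<Rightarrow> complex \<Rightarrow> complex \<Rightarrow> real \<Rightarrow> complex \<Rightarrow> complex \<Rightarrow> complex" where
  "mittag_leffler_Beta \<alpha> \<beta> \<gamma> p x y =
     integral {0..1} (\<lambda>t. of_real t powr (x - 1) * of_real (1 - t) powr (y - 1) *
                  mittag_leffler \<alpha> \<beta> \<gamma> (of_real (- (p / (t * (1 - t))))))"

definition mittag_leffler_hypergeom ::
    "complex \<Rightarrow> complex \<Rightarrow> complex \<Rightarrow> real \<Rightarrow> complex \<Rightarrow> complex \<Rightarrow> complex \<Rightarrow> complex \<Rightarrow> complex" where
  "mittag_leffler_hypergeom \<alpha> \<beta> \<gamma> p a b c z =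
     (\<Sum>n. pochhammer a n * (mittag_leffler_Beta \<alpha> \<beta> \<gamma> p (b + of_nat n) (c - b) / Beta b (c - b)) *
           z ^ n / fact n)"

definition gauss_hypergeom :: "complex \<Rightarrow> complex \<Rightarrow> complex \<Rightarrow> complex \<Rightarrow> complex" where
  "gauss_hypergeom a b c z =
     (\<Sum>n. pochhammer a n * pochhammer b n / pochhammer c n * z ^ n / fact n)"

definition mellin :: "(real \<Rightarrow> complex) \<Rightarrow> complex \<Rightarrow> complex" where
  "mellin f s = integral {0..} (\<lambda>p. of_real p powr (s - 1) * f p)"

end

theory Submission
  imports Defs "HOL-Real_Asymp.Real_Asymp"
begin

text \<open>
  Write \<open>e u\<close> for the Mittag-Leffler function at \<open>-u\<close> and \<open>G v\<close> for the integral of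
  \<open>u powr (s - 1) * e u\<close> over \<open>{0..v}\<close>, a bounded function with limit \<open>L\<close> at infinity. The integral
  defining \<open>L\<close> may converge only conditionally, so Fubini is not available. Instead, with
  \<open>q t = t * (1 - t)\<close> the function
  \<open>H P = integral {0..1} (\<lambda>t. t powr (x + s - 1) * (1 - t) powr (y + s - 1) * G (P / q t))\<close>
  converges absolutely, tends to \<open>0\<close> at \<open>0\<close> and to \<open>L * Beta (x + s) (y + s)\<close> at infinity, and its
  derivative is \<open>P powr (s - 1)\<close> times the generalized beta function. The theorem is then the
  fundamental theorem of calculus for the sum over \<open>n\<close> of such functions with \<open>x = b + n\<close>.
  Differentiating under the integral sign needs locally uniform control of the conditionally
  convergent ends \<open>t \<rightarrow> 0\<close> and \<open>t \<rightarrow> 1\<close>; this comes from integrating by parts, which trades \<open>e\<close> for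
  the bounded function \<open>G\<close>. The bound grows only linearly in \<open>n\<close>, hence the series can be
  differentiated termwise.
\<close>

subsection \<open>The Euler beta integral with complex parameters\<close>

text \<open>Continuity and the bound are asked for on the open interval only, since the weights
  below may be unbounded near the end points; the end points form a null set.\<close>

lemma absolutely_integrable_on_Icc_if_bounded:
  fixes f :: "real \<Rightarrow> complex"
  assumes "continuous_on {a<..<b} f" "g integrable_on {a..b}"
    and "\<And>t. t \<in> {a<..<b} \<Longrightarrow> norm (f t) \<le> g t"
  shows "f absolutely_integrable_on {a..b}"
proof -
  have "g integrable_on {a<..<b}"
    using assms(2) by (simp add: integrable_on_Icc_iff_Ioo)
  then have "f absolutely_integrable_on {a<..<b}"
    using assms
    by (intro measurable_bounded_by_integrable_imp_absolutely_integrable[where g = g]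
        continuous_imp_measurable_on_sets_lebesgue) auto
  then show ?thesis
    by (simp add: absolutely_integrable_on_def integrable_on_Icc_iff_Ioo)
qed

lemma norm_of_real_powr:
  "t \<ge> 0 \<Longrightarrow> norm (complex_of_real t powr z) = t powr Re z"
  by (simp add: norm_powr_real_powr)

lemma continuous_on_powr_mult_powr:
  "continuous_on {0<..<1} (\<lambda>t. complex_of_real t powr x * of_real (1 - t) powr y)"
  by (intro continuous_intros) (auto simp: complex_nonpos_Reals_iff)

lemma absolutely_integrable_beta_weight:
  assumes "Re x > 0" "Re y > 0"
  shows "(\<lambda>t. complex_of_real t powr (x - 1) * of_real (1 - t) powr (y - 1))
           absolutely_integrable_on {0..1}"
proof (rule absolutely_integrable_on_Icc_if_bounded[OF continuous_on_powr_mult_powr])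
  show "(\<lambda>t. t powr (Re x - 1) * (1 - t) powr (Re y - 1)) integrable_on {0..1}"
    using assms by (intro integrable_Beta')
next
  fix t :: real assume "t \<in> {0<..<1}"
  then show "norm (complex_of_real t powr (x - 1) * of_real (1 - t) powr (y - 1))
      \<le> t powr (Re x - 1) * (1 - t) powr (Re y - 1)"
    using norm_of_real_powr[of "1 - t" "y - 1"] by (simp add: norm_mult norm_of_real_powr)
qed

lemma has_vector_derivative_of_real_powr:
  assumes "t > 0"
  shows "((\<lambda>t. complex_of_real t powr z) has_vector_derivative z * of_real t powr (z - 1)) (at t)"
  using assms
  by (intro has_vector_derivative_real_field has_field_derivative_powr)
     (auto simp: complex_nonpos_Reals_iff)

lemma has_vector_derivative_of_real_powr_one_minus:
  assumes "t < 1"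
  shows "((\<lambda>t. complex_of_real (1 - t) powr z) has_vector_derivative
           - (z * of_real (1 - t) powr (z - 1))) (at t)"
proof -
  have "((\<lambda>t. complex_of_real t powr z) \<circ> (\<lambda>t. 1 - t) has_vector_derivative
      (-1) *\<^sub>R (z * of_real (1 - t) powr (z - 1))) (at t)"
    by (rule vector_diff_chain_at)
       (use assms has_vector_derivative_of_real_powr[of "1 - t" z] in \<open>auto intro!: derivative_eq_intros\<close>)
  then show ?thesis by (simp add: o_def)
qed

lemma powr_minus_one_mult:
  "t > 0 \<Longrightarrow> complex_of_real t powr z = of_real t * of_real t powr (z - 1)"
  by (simp add: powr_diff)

text \<open>Integrate the derivative of \<open>t powr x * (1 - t) powr y\<close>, which vanishes at
  both end points. Writing \<open>t = 1 - (1 - t)\<close> in the derivative leaves exactly the two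
  beta integrands of the recurrence.\<close>

lemma beta_integral_recurrence:
  fixes x y :: complex
  assumes "Re x > 0" "Re y > 0"
  defines "I \<equiv> \<lambda>y. integral {0..1} (\<lambda>t. complex_of_real t powr (x - 1) * of_real (1 - t) powr (y - 1))"
  shows "(x + y) * I (y + 1) = y * I y"
proof -
  let ?w = "\<lambda>y t. complex_of_real t powr (x - 1) * of_real (1 - t) powr (y - 1)"
  let ?F = "\<lambda>t. complex_of_real t powr x * of_real (1 - t) powr y"
  have "((\<lambda>t. (x + y) * ?w (y + 1) t - y * ?w y t) has_integral ?F 1 - ?F 0) {0..1}"
  proof (rule fundamental_theorem_of_calculus_interior)
    show "continuous_on {0..1} ?F"
      using assms by (intro continuous_intros continuous_on_powr_complex) auto
  next
    fix t :: real assume t: "t \<in> {0<..<1}"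
    have "(?F has_vector_derivative
        of_real t powr x * - (y * of_real (1 - t) powr (y - 1)) +
        x * of_real t powr (x - 1) * of_real (1 - t) powr y) (at t)"
      using t by (intro has_vector_derivative_mult has_vector_derivative_of_real_powr
          has_vector_derivative_of_real_powr_one_minus) auto
    moreover have "of_real t powr x * - (y * of_real (1 - t) powr (y - 1)) +
        x * of_real t powr (x - 1) * of_real (1 - t) powr y = (x + y) * ?w (y + 1) t - y * ?w y t"
    proof -
      have *: "X * - (y * B) + x * A * Y = (x + y) * (A * Y) - y * (A * B)"
        if "X = of_real t * A" "Y = of_real (1 - t) * B" for X Y A B :: complex
        unfolding that by (simp add: algebra_simps)
      show ?thesis
        using t *[OF powr_minus_one_mult[of t x] powr_minus_one_mult[of "1 - t" y]] by simp
    qed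
    ultimately show "(?F has_vector_derivative (x + y) * ?w (y + 1) t - y * ?w y t) (at t)"
      by simp
  qed auto
  moreover have "((\<lambda>t. (x + y) * ?w (y + 1) t - y * ?w y t) has_integral
      (x + y) * I (y + 1) - y * I y) {0..1}"
    unfolding I_def
    by (intro has_integral_diff has_integral_mult_right integrable_integral
        set_lebesgue_integral_eq_integral(1) absolutely_integrable_beta_weight) (use assms in auto)
  ultimately have "(x + y) * I (y + 1) - y * I y = ?F 1 - ?F 0"
    by (rule has_integral_unique[symmetric])
  then show ?thesis by simp
qed

lemma beta_integral_shift:
  fixes x y :: complex
  assumes "Re x > 0" "Re y > 0"
  defines "I \<equiv> \<lambda>y. integral {0..1} (\<lambda>t. complex_of_real t powr (x - 1) * of_real (1 - t) powr (y - 1))"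
  shows "pochhammer (x + y) n * I (y + of_nat n) = pochhammer y n * I y"
proof (induction n)
  case (Suc n)
  have "(x + (y + of_nat n)) * I (y + of_nat n + 1) = (y + of_nat n) * I (y + of_nat n)"
    unfolding I_def by (rule beta_integral_recurrence) (use assms in auto)
  then have "pochhammer (x + y) (Suc n) * I (y + of_nat (Suc n)) =
      (y + of_nat n) * (pochhammer (x + y) n * I (y + of_nat n))"
    by (simp add: pochhammer_Suc add_ac mult_ac)
  also have "\<dots> = pochhammer y (Suc n) * I y"
    by (simp add: Suc.IH pochhammer_Suc mult_ac)
  finally show ?case .
qed simp

text \<open>The substitution \<open>t = u / n\<close> prepares a limit: with
  \<open>y + n + 1\<close> in place of \<open>y\<close>, the second factor becomes
  \<open>(1 - u / n) powr (y + n)\<close>, which tends to \<open>exp (-u)\<close>.\<close>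

lemma beta_integral_rescaled:
  fixes x y :: complex
  assumes "Re x > 0" "Re y > 0" "n > 0"
  defines "I \<equiv> \<lambda>y. integral {0..1} (\<lambda>t. complex_of_real t powr (x - 1) * of_real (1 - t) powr (y - 1))"
  shows "((\<lambda>u. of_real u powr (x - 1) * of_real (1 - u / real n) powr (y - 1)) has_integral
            of_nat n powr x * I y) {0..real n}"
proof -
  let ?w = "\<lambda>t. complex_of_real t powr (x - 1) * of_real (1 - t) powr (y - 1)"
  have "(?w has_integral I y) (cbox 0 1)"
    unfolding I_def cbox_interval
    by (intro integrable_integral set_lebesgue_integral_eq_integral(1) absolutely_integrable_beta_weight assms)
  from has_integral_affinity[OF this, of "1 / real n" 0]
  have "((\<lambda>u. ?w (u / real n)) has_integral of_nat n * I y) {0..real n}"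
    using assms by (simp add: image_mult_atLeastAtMost scaleR_conv_of_real)
  from has_integral_mult_right[OF this, of "of_nat n powr (x - 1)"]
  have "((\<lambda>u. of_nat n powr (x - 1) * ?w (u / real n)) has_integral of_nat n powr x * I y) {0..real n}"
    using powr_minus_one_mult[of "real n" x] assms by (simp add: mult_ac)
  moreover have "of_nat n powr (x - 1) * ?w (u / real n) =
      of_real u powr (x - 1) * of_real (1 - u / real n) powr (y - 1)"
    if "u \<in> {0..real n}" for u
  proof -
    have "of_real (real n) powr (x - 1) * complex_of_real (u / real n) powr (x - 1)
        = of_real (real n * (u / real n)) powr (x - 1)"
      using that unfolding of_real_mult by (intro powr_times_real[symmetric]) auto
    then show ?thesis using assms by (simp add: mult_ac)
  qed
  ultimately show ?thesis by (rule has_integral_eq[rotated]) 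
qed

text \<open>Dominated convergence to Euler's integral for \<open>Gamma x\<close>. The majorant
  \<open>u powr (Re x - 1) / exp u\<close> comes from
  \<open>(1 - u / n) ^ n \<le> exp (-u)\<close>.\<close>

lemma beta_integral_limit:
  fixes x y :: complex
  assumes "Re x > 0" "Re y > 0"
  defines "I \<equiv> \<lambda>y. integral {0..1} (\<lambda>t. complex_of_real t powr (x - 1) * of_real (1 - t) powr (y - 1))"
  shows "(\<lambda>n. of_nat n powr x * I (y + of_nat n + 1)) \<longlonglongrightarrow> Gamma x"
proof -
  define f where "f = (\<lambda>n u. if u \<in> {0..real n}
    then of_real u powr (x - 1) * of_real (1 - u / real n) powr (y + of_nat n) else (0::complex))"
  have f: "(f n has_integral of_nat n powr x * I (y + of_nat n + 1)) {0..}" for n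
  proof (cases "n = 0")
    \<comment> \<open>By the convention \<open>0 powr z = 0\<close> both the function and the
      claimed value vanish for \<open>n = 0\<close>, so the index need not be shifted.\<close>
    case True
    then have "f n = (\<lambda>_. 0)" "complex_of_nat n powr x = 0" by (auto simp: f_def)
    then show ?thesis by simp
  next
    case False
    then have "((\<lambda>u. of_real u powr (x - 1) * of_real (1 - u / real n) powr (y + of_nat n)) has_integral
            of_nat n powr x * I (y + of_nat n + 1)) {0..real n}"
      using beta_integral_rescaled[of x "y + of_nat n + 1" n] assms by simp
    then show ?thesis
      unfolding f_def by (subst has_integral_restrict) auto
  qed
  have "(\<lambda>n. integral {0..} (f n)) \<longlonglongrightarrow> integral {0..} (\<lambda>u. of_real u powr (x - 1) / of_real (exp u))"
  proof (rule dominated_convergence)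
    show "f n integrable_on {0..}" for n using f by (rule has_integral_integrable)
    show "(\<lambda>u. u powr (Re x - 1) / exp u) integrable_on {0..}"
      by (rule has_integral_integrable[OF Gamma_integral_real]) (use assms in auto)
  next
    fix n and u :: real assume u: "u \<in> {0..}"
    show "norm (f n u) \<le> u powr (Re x - 1) / exp u"
    proof (cases "u \<in> {0..real n} \<and> n > 0")
      case True
      then have v: "0 \<le> 1 - u / real n" "1 - u / real n \<le> 1" by (auto simp: field_simps)
      have "(1 - u / real n) powr (Re y + real n) \<le> (1 - u / real n) powr real n"
        using v assms by (intro powr_mono') auto
      also have "\<dots> = (1 - u / real n) ^ n"
        using v True by (cases "1 - u / real n = 0") (auto simp: powr_realpow)
      also have "\<dots> \<le> exp (-u)"
        using True by (intro exp_ge_one_minus_x_over_n_power_n) auto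
      finally have "u powr (Re x - 1) * (1 - u / real n) powr (Re y + real n) \<le> u powr (Re x - 1) * exp (-u)"
        by (intro mult_left_mono) auto
      moreover have "norm (f n u) = u powr (Re x - 1) * (1 - u / real n) powr (Re y + real n)"
        using True v norm_of_real_powr[OF v(1)] by (simp add: f_def norm_mult norm_of_real_powr)
      ultimately show ?thesis by (simp add: exp_minus field_simps)
    qed (use u in \<open>auto simp: f_def\<close>)
  next
    fix u :: real assume "u \<in> {0..}"
    then have u: "u \<ge> 0" by simp
    have v: "(\<lambda>n. 1 - u / real n) \<longlonglongrightarrow> 1" by real_asymp
    have "(\<lambda>n. of_real u powr (x - 1) * (of_real (1 - u / real n) powr y * of_real ((1 - u / real n) ^ n)))
        \<longlonglongrightarrow> of_real u powr (x - 1) * (of_real 1 powr y * of_real (exp (-u)))"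
      using tendsto_exp_limit_sequentially[of "-u"]
      by (intro tendsto_mult tendsto_const tendsto_powr_complex tendsto_of_real v) auto
    moreover have "eventually (\<lambda>n. of_real u powr (x - 1) *
        (of_real (1 - u / real n) powr y * of_real ((1 - u / real n) ^ n)) = f n u) sequentially"
      using eventually_gt_at_top[of "nat \<lceil>u\<rceil>"]
    proof eventually_elim
      case (elim n)
      then have n: "u < real n" by linarith
      then have "1 - u / real n > 0" using u by (simp add: field_simps)
      then have "complex_of_real (1 - u / real n) powr (y + of_nat n) =
          of_real (1 - u / real n) powr y * of_real ((1 - u / real n) ^ n)"
        unfolding powr_add
        by (subst powr_complexpow) (use \<open>1 - u / real n > 0\<close> in \<open>simp_all only: of_real_power of_real_eq_0_iff\<close>)
      then show ?case using n u by (simp add: f_def)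
    qed
    ultimately have "(\<lambda>n. f n u) \<longlonglongrightarrow> of_real u powr (x - 1) * (of_real 1 powr y * of_real (exp (-u)))"
      by (rule Lim_transform_eventually)
    then show "(\<lambda>n. f n u) \<longlonglongrightarrow> of_real u powr (x - 1) / of_real (exp u)"
      by (simp add: exp_minus divide_inverse)
  qed
  moreover have "integral {0..} (\<lambda>u. of_real u powr (x - 1) / of_real (exp u)) = Gamma x"
    using Gamma_integral_complex[of x] assms by (simp add: integral_unique)
  ultimately show ?thesis using integral_unique[OF f] by simp
qed

text \<open>The recurrence reduces the claim to \<open>y + n + 1\<close>; there the limit \<open>n \<rightarrow> \<infinity>\<close> is a Gamma integral.\<close>
theorem has_integral_Beta_complex:
  fixes x y :: complex
  assumes "Re x > 0" "Re y > 0"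
  shows "((\<lambda>t. complex_of_real t powr (x - 1) * of_real (1 - t) powr (y - 1)) has_integral Beta x y) {0..1}"
proof -
  define I where "I \<equiv> \<lambda>y. integral {0..1} (\<lambda>t. complex_of_real t powr (x - 1) * of_real (1 - t) powr (y - 1))"
  have nonpole: "w \<notin> \<int>\<^sub>\<le>\<^sub>0" if "Re w > 0" for w :: complex
  proof
    assume "w \<in> \<int>\<^sub>\<le>\<^sub>0"
    then obtain k where "w = of_int k" "k \<le> 0" by (rule nonpos_Ints_cases)
    with that show False by simp
  qed
  have "(\<lambda>n. rGamma_series (x + y) n * (of_nat n powr x * I (y + of_nat n + 1)))
      \<longlonglongrightarrow> rGamma (x + y) * Gamma x"
    unfolding I_def by (intro tendsto_mult rGamma_series_LIMSEQ beta_integral_limit assms)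
  \<comment> \<open>\<open>rGamma_series\<close> at index \<open>n\<close> contains a Pochhammer
    symbol of length \<open>n + 1\<close>, so the recurrence is applied \<open>n + 1\<close> times;
    its power of \<open>n\<close> with exponent \<open>-(x + y)\<close> combines with
    \<open>n powr x\<close> to exponent \<open>-y\<close>. The two sequences thus agree exactly, and
    comparing their limits determines \<open>I y\<close>.\<close>
  moreover have "eventually (\<lambda>n. rGamma_series (x + y) n * (of_nat n powr x * I (y + of_nat n + 1))
      = rGamma_series y n * I y) sequentially"
    using eventually_gt_at_top[of 0]
  proof eventually_elim
    case (elim n)
    have "pochhammer (x + y) (n + 1) * I (y + of_nat (n + 1)) = pochhammer y (n + 1) * I y"
      unfolding I_def by (rule beta_integral_shift) (use assms in auto)
    moreover have "exp ((x + y) * of_real (ln (of_nat n))) =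
        exp (y * of_real (ln (of_nat n))) * of_nat n powr x"
      using elim by (simp add: powr_def exp_add[symmetric] algebra_simps)
    ultimately show ?case
      using elim by (simp add: rGamma_series_def add_ac field_simps)
  qed
  ultimately have "(\<lambda>n. rGamma_series y n * I y) \<longlonglongrightarrow> rGamma (x + y) * Gamma x"
    by (rule Lim_transform_eventually)
  moreover have "(\<lambda>n. rGamma_series y n * I y) \<longlonglongrightarrow> rGamma y * I y"
    by (intro tendsto_intros rGamma_series_LIMSEQ)
  ultimately have "rGamma y * I y = rGamma (x + y) * Gamma x"
    by (rule LIMSEQ_unique[rotated])
  then have "I y = Beta x y"
    using nonpole[OF assms(2)] nonpole[OF assms(1)]
    by (simp add: Beta_altdef Gamma_def rGamma_eq_zero_iff divide_simps mult_ac)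
  moreover have "((\<lambda>t. complex_of_real t powr (x - 1) * of_real (1 - t) powr (y - 1)) has_integral I y) {0..1}"
    unfolding I_def by (intro integrable_integral set_lebesgue_integral_eq_integral(1)
        absolutely_integrable_beta_weight assms)
  ultimately show ?thesis by simp
qed

subsection \<open>The Mittag-Leffler function is entire\<close>

lemma not_nonpos_Ints_if_Re_pos: "Re w > 0 \<Longrightarrow> w \<notin> \<int>\<^sub>\<le>\<^sub>0"
  by (metis Re_complex_of_real complex_nonpos_Reals_iff leD nonpos_Ints_subset_nonpos_Reals subsetD)

lemma norm_Beta_le:
  assumes "Re x > 0" "Re y > 0"
  shows "norm (Beta x y) \<le> Beta (Re x) (Re y)"
proof -
  have "norm (integral {0..1} (\<lambda>t. complex_of_real t powr (x - 1) * of_real (1 - t) powr (y - 1)))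
      \<le> integral {0..1} (\<lambda>t. t powr (Re x - 1) * (1 - t) powr (Re y - 1))"
  proof (rule integral_norm_bound_integral)
    fix t :: real assume "t \<in> {0..1}"
    then show "norm (complex_of_real t powr (x - 1) * of_real (1 - t) powr (y - 1))
      \<le> t powr (Re x - 1) * (1 - t) powr (Re y - 1)"
      using norm_of_real_powr[of "1 - t" "y - 1"] by (simp add: norm_mult norm_of_real_powr)
  qed (use has_integral_Beta_complex[OF assms] has_integral_Beta_real[OF assms] in auto)
  then show ?thesis
    using has_integral_Beta_complex[OF assms] has_integral_Beta_real[OF assms]
    by (simp add: integral_unique)
qed

text \<open>Along the integers this is dominated convergence, as \<open>t ^ k\<close> tends to
  \<open>0\<close> for \<open>t < 1\<close>; monotonicity of \<open>Beta\<close> in its first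
  argument extends it to real arguments.\<close>

lemma Beta_real_tendsto_0:
  fixes r :: real
  assumes "r > 0"
  shows "((\<lambda>x. Beta x r) \<longlongrightarrow> 0) at_top"
proof -
  let ?f = "\<lambda>k t. t powr (real (k + 1) - 1) * (1 - t) powr (r - 1)"
  have int: "(?f k has_integral Beta (real (k + 1)) r) {0..1}" for k
    using assms by (intro has_integral_Beta_real) auto
  have "(\<lambda>k. integral {0..1} (?f k)) \<longlonglongrightarrow> integral {0..1} (\<lambda>_::real. 0)"
  proof (rule dominated_convergence)
    show "?f k integrable_on {0..1}" for k
      using int by (rule has_integral_integrable)
    show "(\<lambda>t. (1 - t) powr (r - 1)) integrable_on {0..1}"
    proof -
      \<comment> \<open>The majorant is the case \<open>k = 0\<close>, except at
        \<open>t = 0\<close>, where \<open>0 powr 0 = 0\<close>.\<close>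
      have "?f 0 integrable_on {0..1}" using int by (rule has_integral_integrable)
      then show ?thesis
        by (rule integrable_spike_finite[of "{0}", rotated 2]) auto
    qed
    show "norm (?f k t) \<le> (1 - t) powr (r - 1)" if "t \<in> {0..1}" for k t
      using that powr_mono2[of "real k" t 1] by (auto simp: abs_mult intro!: mult_left_le_one_le)
    show "(\<lambda>k. ?f k t) \<longlonglongrightarrow> 0" if "t \<in> {0..1}" for t
    proof (cases "t = 1")
      case False
      have "(\<lambda>k. t ^ k * (1 - t) powr (r - 1)) \<longlonglongrightarrow> 0 * (1 - t) powr (r - 1)"
        using that False by (intro tendsto_intros LIMSEQ_realpow_zero) auto
      moreover have "eventually (\<lambda>k. t ^ k * (1 - t) powr (r - 1) = ?f k t) sequentially"
        using eventually_gt_at_top[of 0]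
        by eventually_elim (use that in \<open>cases "t = 0"; auto simp: powr_realpow\<close>)
      ultimately show ?thesis by (auto intro: Lim_transform_eventually)
    qed simp
  qed
  then have lim: "(\<lambda>k. Beta (real (k + 1)) r) \<longlonglongrightarrow> 0"
    using integral_unique[OF int] by simp
  show ?thesis
  proof (rule tendstoI)
    fix e :: real assume "e > 0"
    then obtain k where k: "Beta (real (k + 1)) r < e"
      using order_tendstoD(2)[OF lim] by (auto simp: eventually_sequentially)
    show "eventually (\<lambda>x. dist (Beta x r) 0 < e) at_top"
      using eventually_ge_at_top[of "real (k + 1)"]
    proof eventually_elim
      case (elim x)
      have "Beta x r \<le> Beta (real (k + 1)) r"
        using elim assms by (intro Beta_real_mono) auto
      moreover have "0 \<le> Beta x r"
        using elim assms by (simp add: Beta_def Gamma_real_pos less_imp_le)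
      ultimately show ?case using k by simp
    qed
  qed
qed

text \<open>The Beta-Gamma relation solved for the shifted factor. Consecutive Mittag-Leffler
  coefficients differ by such a shift, so the growth of Gamma is read off from a Beta value instead
  of Stirling's formula.\<close>

lemma rGamma_add:
  assumes "Re w > 0" "Re \<alpha> > 0"
  shows "rGamma (w + \<alpha>) = rGamma w * (Beta w \<alpha> * rGamma \<alpha>)"
  using assms not_nonpos_Ints_if_Re_pos[of w] not_nonpos_Ints_if_Re_pos[of \<alpha>]
  by (simp add: Beta_altdef Gamma_def rGamma_eq_zero_iff divide_simps)

text \<open>The ratio of consecutive Gamma factors is a Beta value, which tends to \<open>0\<close>.\<close>
lemma summable_mittag_leffler:
  fixes \<alpha> \<beta> \<gamma> z :: complex
  assumes "Re \<alpha> > 0"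
  shows "summable (\<lambda>n. pochhammer \<gamma> n * rGamma (\<alpha> * of_nat n + \<beta>) / fact n * z ^ n)"
    (is "summable ?f")
proof -
  define w where "w = (\<lambda>n. \<alpha> * of_nat n + \<beta>)"
  \<comment> \<open>All of the ratio of consecutive terms except the Beta value;
    \<open>norm \<gamma> + 1\<close> bounds \<open>norm (\<gamma> + n) / (n + 1)\<close>.\<close>
  define K where "K = norm z * (norm \<gamma> + 1) * norm (rGamma \<alpha>)"
  have lim: "filterlim (\<lambda>n. Re (w n)) at_top sequentially"
    unfolding w_def using assms by simp real_asymp
  have "(\<lambda>n. K * Beta (Re (w n)) (Re \<alpha>)) \<longlonglongrightarrow> K * 0"
    by (intro tendsto_mult tendsto_const filterlim_compose[OF Beta_real_tendsto_0 lim] assms)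
  then have "eventually (\<lambda>n. K * Beta (Re (w n)) (Re \<alpha>) < 1 / 2) sequentially"
    by (rule order_tendstoD) auto
  moreover have "eventually (\<lambda>n. Re (w n) > 0) sequentially"
    using lim by (simp add: filterlim_at_top_dense)
  ultimately have "eventually (\<lambda>n. norm (?f (Suc n)) \<le> 1 / 2 * norm (?f n)) sequentially"
  proof eventually_elim
    case (elim n)
    define q where "q = z * ((\<gamma> + of_nat n) / of_nat (Suc n)) * (Beta (w n) \<alpha> * rGamma \<alpha>)"
    have "rGamma (\<alpha> * of_nat (Suc n) + \<beta>) = rGamma (\<alpha> * of_nat n + \<beta>) * (Beta (w n) \<alpha> * rGamma \<alpha>)"
      using rGamma_add[OF elim(2) assms] by (simp add: w_def algebra_simps)
    then have "?f (Suc n) = ?f n * q"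
      by (simp add: pochhammer_Suc q_def mult_ac)
    moreover have "norm q \<le> 1 / 2"
    proof -
      have "norm (\<gamma> + of_nat n) \<le> norm \<gamma> + real n"
        using norm_triangle_ineq[of \<gamma> "of_nat n"] by simp
      also have "\<dots> \<le> (norm \<gamma> + 1) * real (Suc n)" by (simp add: algebra_simps)
      finally have "norm ((\<gamma> + of_nat n) / of_nat (Suc n)) \<le> norm \<gamma> + 1"
        by (simp add: norm_divide divide_le_eq del: of_nat_Suc)
      moreover have "0 \<le> Beta (Re (w n)) (Re \<alpha>)"
        by (rule order_trans[OF norm_ge_zero norm_Beta_le]) (use elim assms in auto)
      ultimately have "norm q \<le> norm z * (norm \<gamma> + 1) * (Beta (Re (w n)) (Re \<alpha>) * norm (rGamma \<alpha>))"
        unfolding q_def norm_mult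
        by (intro mult_mono norm_Beta_le) (use elim assms in auto)
      also have "\<dots> \<le> 1 / 2" using elim by (simp add: K_def mult_ac)
      finally show ?thesis .
    qed
    ultimately show ?case
      by (simp only: norm_mult[of _ q] mult.commute[of _ "norm q"] mult_right_mono norm_ge_zero)
  qed
  then obtain N where "\<And>n. n \<ge> N \<Longrightarrow> norm (?f (Suc n)) \<le> 1 / 2 * norm (?f n)"
    by (auto simp: eventually_sequentially)
  then show ?thesis by (intro summable_ratio_test[of "1 / 2" N]) auto
qed

lemma continuous_on_mittag_leffler:
  assumes "Re \<alpha> > 0"
  shows "continuous_on A (mittag_leffler \<alpha> \<beta> \<gamma>)"
proof -
  have "mittag_leffler \<alpha> \<beta> \<gamma> =
      (\<lambda>z. \<Sum>n. pochhammer \<gamma> n * rGamma (\<alpha> * of_nat n + \<beta>) / fact n * z ^ n)"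
    by (simp add: mittag_leffler_def fun_eq_iff)
  moreover have "isCont (\<lambda>z. \<Sum>n. pochhammer \<gamma> n * rGamma (\<alpha> * of_nat n + \<beta>) / fact n * z ^ n) z" for z
    by (intro isCont_powser_converges_everywhere summable_mittag_leffler assms)
  ultimately show ?thesis by (simp add: continuous_at_imp_continuous_on)
qed

subsection \<open>Beta transforms of a kernel with convergent Mellin integral\<close>

lemma of_real_powr_quotient:
  assumes "p > 0" "t > 0" "u > 0"
  shows "complex_of_real (p / (t * u)) powr z =
    of_real p powr z * of_real t powr (-z) * of_real u powr (-z)"
  using assms
  by (simp add: powr_def Ln_of_real ln_div ln_mult exp_add[symmetric] algebra_simps
      flip: of_real_mult of_real_divide)

definition beta_weight :: "complex \<Rightarrow> complex \<Rightarrow> real \<Rightarrow> complex" where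
  "beta_weight x y t = of_real t powr (x - 1) * of_real (1 - t) powr (y - 1)"

lemma beta_weight_swap: "beta_weight x y (1 - t) = beta_weight y x t"
  by (simp add: beta_weight_def)

lemma norm_beta_weight:
  "t \<in> {0..1} \<Longrightarrow> norm (beta_weight x y t) = t powr (Re x - 1) * (1 - t) powr (Re y - 1)"
  using norm_of_real_powr[of "1 - t" "y - 1"]
  by (simp add: beta_weight_def norm_mult norm_of_real_powr)

lemma continuous_on_beta_weight:
  "A \<subseteq> {0<..<1} \<Longrightarrow> continuous_on A (beta_weight x y)"
  unfolding beta_weight_def by (rule continuous_on_subset[OF continuous_on_powr_mult_powr])

text \<open>
  The factor multiplying the derivative of \<open>t \<mapsto> G (p / (t * (1 - t)))\<close> when the generalized beta
  integrand is integrated by parts. It is singular at \<open>1 / 2\<close>, where \<open>t * (1 - t)\<close> is critical, so it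
  is used on \<open>{0..1 / 4}\<close> only.
\<close>
definition primitive_weight :: "complex \<Rightarrow> complex \<Rightarrow> real \<Rightarrow> complex" where
  "primitive_weight x y t = of_real t powr x * of_real (1 - t) powr y / of_real (1 - 2 * t)"

text \<open>Written as the function times its logarithmic derivative, so that the bound on
  \<open>primitive_weight\<close> can be reused.\<close>

definition primitive_weight_deriv :: "complex \<Rightarrow> complex \<Rightarrow> real \<Rightarrow> complex" where
  "primitive_weight_deriv x y t = primitive_weight x y t *
     (x / of_real t - y / of_real (1 - t) + 2 / of_real (1 - 2 * t))"

lemma primitive_weight_has_vector_derivative:
  assumes "0 < t" "t < 1 / 2"
  shows "(primitive_weight x y has_vector_derivative primitive_weight_deriv x y t) (at t)"
proof -
  let ?A = "\<lambda>t. complex_of_real t powr x" and ?B = "\<lambda>t. complex_of_real (1 - t) powr y"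
    and ?C = "\<lambda>t. complex_of_real (inverse (1 - 2 * t))"
  have A: "(?A has_vector_derivative ?A t * (x / of_real t)) (at t)"
    using has_vector_derivative_of_real_powr[of t x] powr_minus_one_mult[of t x] assms
    by (simp add: mult.commute)
  have B: "(?B has_vector_derivative ?B t * (- y / of_real (1 - t))) (at t)"
    using has_vector_derivative_of_real_powr_one_minus[of t y] powr_minus_one_mult[of "1 - t" y] assms
    by (simp add: mult.commute)
  have "((\<lambda>t. inverse (1 - 2 * t)) has_real_derivative inverse (1 - 2 * t) * (2 / (1 - 2 * t))) (at t)"
    using assms by (auto intro!: derivative_eq_intros simp: divide_simps power2_eq_square)
  then have "(?C has_vector_derivative of_real (inverse (1 - 2 * t) * (2 / (1 - 2 * t)))) (at t)"
    by (rule has_vector_derivative_of_real)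
  then have C: "(?C has_vector_derivative ?C t * (2 / of_real (1 - 2 * t))) (at t)"
    by (simp only: of_real_mult of_real_divide of_real_numeral)
  have "((\<lambda>t. ?A t * ?B t * ?C t) has_vector_derivative primitive_weight_deriv x y t) (at t)"
    by (rule has_vector_derivative_eq_rhs[OF
          has_vector_derivative_mult[OF has_vector_derivative_mult[OF A B] C]])
       (simp add: primitive_weight_deriv_def primitive_weight_def divide_inverse algebra_simps)
  then show ?thesis
    by (simp add: primitive_weight_def[abs_def] divide_inverse)
qed

lemma norm_primitive_weight_le:
  assumes "0 \<le> t" "t \<le> 1 / 4" "Re y > 0"
  shows "norm (primitive_weight x y t) \<le> 2 * t powr Re x"
proof -
  have "norm (primitive_weight x y t) = t powr Re x * ((1 - t) powr Re y / (1 - 2 * t))"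
    using assms norm_of_real_powr[of "1 - t" y] norm_of_real[of "1 - 2 * t", where ?'a = complex]
    by (simp add: primitive_weight_def norm_mult norm_divide norm_of_real_powr del: norm_of_real)
  also have "(1 - t) powr Re y \<le> 1 powr Re y"
    using assms by (intro powr_mono2) auto
  then have "(1 - t) powr Re y / (1 - 2 * t) \<le> 1 / (1 / 2)"
    using assms by (intro frac_le) auto
  then have "t powr Re x * ((1 - t) powr Re y / (1 - 2 * t)) \<le> t powr Re x * 2"
    by (intro mult_left_mono) auto
  finally show ?thesis by simp
qed

lemma norm_primitive_weight_deriv_le:
  assumes "0 < t" "t \<le> 1 / 4" "Re y > 0"
  shows "norm (primitive_weight_deriv x y t) \<le> 2 * (norm x + norm y + 1) * t powr (Re x - 1)"
proof -
  have n1: "norm (complex_of_real (1 - t)) = 1 - t" "norm (complex_of_real (1 - 2 * t)) = 1 - 2 * t"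
    unfolding norm_of_real using assms by auto
  have "norm (x / of_real t - y / of_real (1 - t) + 2 / of_real (1 - 2 * t))
      \<le> norm (x / of_real t) + norm (y / of_real (1 - t)) + norm (2 / complex_of_real (1 - 2 * t))"
    by (rule order_trans[OF norm_triangle_ineq add_mono[OF norm_triangle_ineq4 order_refl]])
  also have "\<dots> = norm x / t + norm y / (1 - t) + 2 / (1 - 2 * t)"
    using assms by (simp only: norm_divide n1) simp
  \<comment> \<open>Here \<open>t \<le> 1 / 4\<close> is used sharply: it is equivalent to
    \<open>2 / (1 - 2 * t) \<le> 1 / t\<close>.\<close>
  also have "\<dots> \<le> norm x / t + norm y / t + 1 / t"
    using assms by (intro add_mono divide_left_mono order_refl) (auto simp: divide_simps)
  finally have "norm (x / of_real t - y / of_real (1 - t) + 2 / of_real (1 - 2 * t))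
      \<le> (norm x + norm y + 1) / t"
    by (simp add: add_divide_distrib)
  then have "norm (primitive_weight_deriv x y t) \<le> 2 * t powr Re x * ((norm x + norm y + 1) / t)"
    unfolding primitive_weight_deriv_def norm_mult
    using assms by (intro mult_mono norm_primitive_weight_le) auto
  also have "\<dots> = 2 * (norm x + norm y + 1) * t powr (Re x - 1)"
    using assms by (simp add: powr_diff)
  finally show ?thesis .
qed

lemma has_integral_reflect_Icc:
  fixes f :: "real \<Rightarrow> complex"
  assumes "(f has_integral i) {a..b}"
  shows "((\<lambda>t. f (1 - t)) has_integral i) {1 - b..1 - a}"
proof -
  have "(\<lambda>x. 1 - x) ` {a..b} = {1 - b..1 - a}"
    by (force simp: image_iff)
  then show ?thesis
    using has_integral_affinity[of f i a b "-1" 1] assms by simp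
qed

text \<open>Of the kernel \<open>e\<close> only continuity is assumed, of the primitive
  \<open>G\<close> boundedness and limits at both ends. Absolute convergence of the Mellin integral
  is not assumed, so conditionally convergent ones are covered.\<close>

locale mellin_kernel =
  fixes e G :: "real \<Rightarrow> complex" and s L :: complex and M :: real
  assumes Re_s: "Re s > 0"
    and cont_e: "continuous_on {0<..} e"
    and deriv_G: "v > 0 \<Longrightarrow> (G has_vector_derivative of_real v powr (s - 1) * e v) (at v)"
    and bound_G: "v > 0 \<Longrightarrow> norm (G v) \<le> M"
    and G_at_0: "(G \<longlongrightarrow> 0) (at_right 0)"
    and G_at_top: "(G \<longlongrightarrow> L) at_top"
begin

lemma M_nonneg: "M \<ge> 0"
  using bound_G[of 1] norm_ge_zero[of "G 1"] by linarith

lemma cont_G: "continuous_on {0<..} G"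
  by (intro continuous_at_imp_continuous_on ballI)
     (use has_vector_derivative_continuous[OF deriv_G] in auto)

section \<open>The generalized beta integrand and integration by parts near its end points\<close>

definition beta_integrand :: "complex \<Rightarrow> complex \<Rightarrow> real \<Rightarrow> real \<Rightarrow> complex" where
  "beta_integrand x y p t = beta_weight x y t * e (p / (t * (1 - t)))"

text \<open>Collects the two contributions of the integration by parts at the left end:
  \<open>2\<close> bounds the boundary term, and the quotient arises from integrating the bound on
  \<open>primitive_weight_deriv\<close>, a multiple of
  \<open>t powr (Re (x + s) - 1)\<close>.\<close>

definition tail_const :: "complex \<Rightarrow> complex \<Rightarrow> real" where
  "tail_const x y = 2 + 2 * (norm (x + s) + norm (y + s) + 1) / Re (x + s)"

lemma kernel_has_vector_derivative:
  assumes "p > 0" "0 < t" "t < 1"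
  shows "((\<lambda>t. G (p / (t * (1 - t)))) has_vector_derivative
    of_real (- (p * (1 - 2 * t) / (t * (1 - t))^2)) *
      (of_real (p / (t * (1 - t))) powr (s - 1) * e (p / (t * (1 - t))))) (at t)"
proof -
  have "((\<lambda>t. p / (t * (1 - t))) has_real_derivative - (p * (1 - 2 * t) / (t * (1 - t))^2)) (at t)"
    using assms by (auto intro!: derivative_eq_intros simp: divide_simps power2_eq_square)
  then have "(G \<circ> (\<lambda>t. p / (t * (1 - t))) has_vector_derivative
    (- (p * (1 - 2 * t) / (t * (1 - t))^2)) *\<^sub>R
      (of_real (p / (t * (1 - t))) powr (s - 1) * e (p / (t * (1 - t))))) (at t)"
    using assms by (intro vector_diff_chain_at deriv_G)
      (auto simp: has_real_derivative_iff_has_vector_derivative)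
  then show ?thesis by (simp only: o_def scaleR_conv_of_real)
qed

text \<open>Exhibits the integrand as a weight times the derivative of
  \<open>G (p / (t * (1 - t)))\<close>. That derivative carries the factor \<open>1 - 2 * t\<close>
  of the inner function, which explains the denominator of \<open>primitive_weight\<close>, and the
  power \<open>p powr s\<close>, which the prefactor cancels.\<close>

lemma beta_integrand_eq:
  assumes "p > 0" "0 < t" "t < 1 / 2"
  shows "beta_integrand x y p t = - (of_real p powr (-s)) * (primitive_weight (x + s) (y + s) t *
    (of_real (- (p * (1 - 2 * t) / (t * (1 - t))^2)) *
      (of_real (p / (t * (1 - t))) powr (s - 1) * e (p / (t * (1 - t))))))"
proof -
  \<comment> \<open>With the powers treated as independent variables, only three relations matter:
    those between the exponents of \<open>t\<close>, of \<open>1 - t\<close> and of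
    \<open>p\<close>.\<close>
  have *: "W1 * W2 * E = - P * (A * B / v * (- (p' * v / (t' * u)^2) * (P2 * A2 * B2 * E)))"
    if "A * A2 = W1 * t'^2" "B * B2 = W2 * u^2" "P * P2 * p' = 1" "t' \<noteq> 0" "u \<noteq> 0" "v \<noteq> 0"
    for W1 W2 E P A B v p' t' u P2 A2 B2 :: complex
  proof -
    have "- P * (A * B / v * (- (p' * v / (t' * u)^2) * (P2 * A2 * B2 * E)))
        = (P * P2 * p') * (A * A2) * (B * B2) * E / (t' * u)^2"
      using that(6) by (simp add: mult_ac)
    then show ?thesis
      unfolding that(1-3) using that(4,5) by (simp add: power_mult_distrib)
  qed
  have pow: "complex_of_real r powr (x + s) * of_real r powr (- (s - 1)) = of_real r powr (x - 1) * of_real r ^ 2"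
    if "r > 0" for r x
  proof -
    have "complex_of_real r powr (x + s) * of_real r powr (- (s - 1)) = of_real r powr (x - 1 + 1 + 1)"
      by (simp flip: powr_add)
    also have "\<dots> = of_real r powr (x - 1) * of_real r ^ 2"
      using that by (simp only: powr_add) (simp add: power2_eq_square)
    finally show ?thesis .
  qed
  have powp: "complex_of_real p powr (-s) * of_real p powr (s - 1) * of_real p = 1"
  proof -
    have "complex_of_real p powr (-s) * of_real p powr (s - 1) = of_real p powr (-1)"
      by (simp flip: powr_add)
    then show ?thesis using assms by (simp add: powr_minus)
  qed
  have ne: "complex_of_real t \<noteq> 0" "complex_of_real (1 - t) \<noteq> 0" "complex_of_real (1 - 2 * t) \<noteq> 0"
    using assms by (simp_all only: of_real_eq_0_iff)
  have q: "of_real (p / (t * (1 - t))) powr (s - 1) =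
      complex_of_real p powr (s - 1) * of_real t powr (- (s - 1)) * of_real (1 - t) powr (- (s - 1))"
    using assms by (intro of_real_powr_quotient) auto
  show ?thesis
    unfolding beta_integrand_def beta_weight_def primitive_weight_def q
    unfolding of_real_minus of_real_divide of_real_mult of_real_power
    by (rule *[OF pow pow powp ne]) (use assms in auto)
qed


lemma continuous_on_quotient:
  fixes f :: "real \<Rightarrow> complex"
  assumes "continuous_on {0<..} f" "p > 0" "A \<subseteq> {0<..<1}"
  shows "continuous_on A (\<lambda>t. f (p / (t * (1 - t))))"
proof (rule continuous_on_compose2[OF assms(1)])
  have "t \<noteq> 0 \<and> 1 - t \<noteq> 0" if "t \<in> A" for t using subsetD[OF assms(3) that] by auto
  then show "continuous_on A (\<lambda>t. p / (t * (1 - t)))"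
    by (intro continuous_intros) auto
qed (use assms in auto)

lemma continuous_on_beta_integrand:
  "p > 0 \<Longrightarrow> A \<subseteq> {0<..<1} \<Longrightarrow> continuous_on A (beta_integrand x y p)"
  unfolding beta_integrand_def
  by (intro continuous_on_mult continuous_on_beta_weight continuous_on_quotient cont_e)

text \<open>Integration by parts on \<open>{0..\<eta>}\<close>. The boundary term at
  \<open>0\<close> vanishes because \<open>G\<close> is bounded and \<open>Re (x + s) > 0\<close>;
  the remaining integrand \<open>g\<close> is absolutely integrable for the same reason.
  Integrability of the original integrand, possibly only conditional, is a consequence, and
  \<open>e\<close> enters the bound through \<open>M\<close> alone.\<close>

lemma end_integral:
  assumes "p > 0" "Re x > 0" "Re y > 0" "0 < \<eta>" "\<eta> \<le> 1 / 4"
  shows "beta_integrand x y p integrable_on {0..\<eta>}" (is ?thesis1)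
    and "norm (integral {0..\<eta>} (beta_integrand x y p)) \<le>
           M * p powr (- Re s) * tail_const x y * \<eta> powr Re (x + s)" (is ?thesis2)
proof -
  define \<kappa> where "\<kappa> = Re (x + s)"
  have \<kappa>: "\<kappa> > 0" and ys: "Re (y + s) > 0" using assms Re_s by (auto simp: \<kappa>_def)
  define N where "N = 2 * (norm (x + s) + norm (y + s) + 1)"
  define u where "u = (\<lambda>t. primitive_weight (x + s) (y + s) t * G (p / (t * (1 - t))))"
  define D where "D = (\<lambda>t. of_real (- (p * (1 - 2 * t) / (t * (1 - t))^2)) *
      (of_real (p / (t * (1 - t))) powr (s - 1) * e (p / (t * (1 - t)))))"
  define g where "g = (\<lambda>t. primitive_weight_deriv (x + s) (y + s) t * G (p / (t * (1 - t))))"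
  have G_le: "norm (G (p / (t * (1 - t)))) \<le> M" if "0 < t" "t \<le> 1 / 4" for t
    using that assms by (intro bound_G) auto
  have du: "(u has_vector_derivative
      primitive_weight (x + s) (y + s) t * D t + g t) (at t)" if "0 < t" "t \<le> 1 / 4" for t
    unfolding u_def D_def g_def using that assms
    by (intro has_vector_derivative_mult primitive_weight_has_vector_derivative
        kernel_has_vector_derivative) auto
  have norm_u: "norm (u t) \<le> 2 * M * t powr \<kappa>" if "0 \<le> t" "t \<le> 1 / 4" for t
  proof (cases "t = 0")
    case False
    then have "norm (u t) \<le> (2 * t powr \<kappa>) * M"
      unfolding u_def norm_mult \<kappa>_def using that ys M_nonneg
      by (intro mult_mono norm_primitive_weight_le G_le) auto
    then show ?thesis by (simp add: mult_ac)
  qed (simp add: u_def primitive_weight_def)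
  have cont_u: "continuous_on {0..\<eta>} u"
  proof (rule continuous_on_eq_continuous_within[THEN iffD2], intro ballI)
    fix t assume t: "t \<in> {0..\<eta>}"
    show "continuous (at t within {0..\<eta>}) u"
    proof (cases "t = 0")
      case False
      then have "isCont u t"
        using t assms by (intro has_vector_derivative_continuous[OF du]) auto
      then show ?thesis by (rule continuous_at_imp_continuous_at_within)
    next
      case True
      have "((\<lambda>t. 2 * M * t powr \<kappa>) \<longlongrightarrow> 2 * M * 0 powr \<kappa>) (at 0 within {0..\<eta>})"
        by (intro tendsto_intros tendsto_powr' ) (use \<kappa> in \<open>auto simp: eventually_at_filter\<close>)
      then have "((\<lambda>t. 2 * M * t powr \<kappa>) \<longlongrightarrow> 0) (at 0 within {0..\<eta>})" by simp
      then have "(u \<longlongrightarrow> 0) (at 0 within {0..\<eta>})"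
        by (rule Lim_null_comparison[rotated])
           (use assms norm_u in \<open>auto simp: eventually_at_filter\<close>)
      then show ?thesis using True by (simp add: continuous_within u_def primitive_weight_def)
    qed
  qed
  have pow_int: "((\<lambda>t. M * N * t powr (\<kappa> - 1)) has_integral M * N * (\<eta> powr \<kappa> / \<kappa>)) {0..\<eta>}"
    using has_integral_powr_from_0[of "\<kappa> - 1" \<eta>] assms \<kappa>
    by (intro has_integral_mult_right) auto
  have norm_g: "norm (g t) \<le> M * N * t powr (\<kappa> - 1)" if "t \<in> {0<..<\<eta>}" for t
  proof -
    have "norm (g t) \<le> (N * t powr (\<kappa> - 1)) * M"
      unfolding g_def norm_mult \<kappa>_def N_def using that ys M_nonneg assms
      by (intro mult_mono norm_primitive_weight_deriv_le G_le) auto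
    then show ?thesis by (simp add: mult_ac)
  qed
  have "g absolutely_integrable_on {0..\<eta>}"
  proof (rule absolutely_integrable_on_Icc_if_bounded[OF _ has_integral_integrable[OF pow_int] norm_g])
    have ne: "of_real t \<noteq> (0::complex) \<and> of_real (1 - t) \<noteq> (0::complex) \<and> of_real (1 - 2 * t) \<noteq> (0::complex)"
      if "t \<in> {0<..<\<eta>}" for t
      using that assms unfolding of_real_eq_0_iff by auto
    have "continuous_on {0<..<\<eta>} (primitive_weight_deriv (x + s) (y + s))"
      unfolding primitive_weight_deriv_def primitive_weight_def
      using ne assms
      by (intro continuous_intros continuous_on_powr_complex) (auto simp del: of_real_diff)
    then show "continuous_on {0<..<\<eta>} g"
      unfolding g_def using assms
      by (intro continuous_on_mult continuous_on_quotient cont_G) auto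
  qed
  then have int_g: "g integrable_on {0..\<eta>}" by (rule set_lebesgue_integral_eq_integral(1))
  have "norm (integral {0<..<\<eta>} g) \<le> integral {0<..<\<eta>} (\<lambda>t. M * N * t powr (\<kappa> - 1))"
    using int_g has_integral_integrable[OF pow_int] norm_g
    by (intro integral_norm_bound_integral) (auto simp: integrable_on_Icc_iff_Ioo)
  then have norm_int_g: "norm (integral {0..\<eta>} g) \<le> M * N * (\<eta> powr \<kappa> / \<kappa>)"
    using integral_unique[OF pow_int] by (simp add: integral_open_interval_real)
  \<comment> \<open>The fundamental theorem applies to the whole derivative of \<open>u\<close>;
    subtracting the integrable part \<open>g\<close> isolates the part containing
    \<open>e\<close>.\<close>
  have "((\<lambda>t. primitive_weight (x + s) (y + s) t * D t + g t) has_integral (u \<eta> - u 0)) {0..\<eta>}"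
    using assms du by (intro fundamental_theorem_of_calculus_interior cont_u) auto
  from has_integral_diff[OF this integrable_integral[OF int_g]]
  have "((\<lambda>t. primitive_weight (x + s) (y + s) t * D t + g t - g t) has_integral
      (u \<eta> - integral {0..\<eta>} g)) {0..\<eta>}"
    by (simp add: u_def primitive_weight_def)
  then have scaled: "((\<lambda>t. - (of_real p powr (-s)) * (primitive_weight (x + s) (y + s) t * D t)) has_integral
      - (of_real p powr (-s)) * (u \<eta> - integral {0..\<eta>} g)) {0..\<eta>}"
    by (intro has_integral_mult_right) simp
  have eq: "beta_integrand x y p t =
      - (of_real p powr (-s)) * (primitive_weight (x + s) (y + s) t * D t)" if "t \<in> {0..\<eta>} - {0}" for t
    unfolding D_def by (rule beta_integrand_eq) (use that assms in auto)
  have main: "(beta_integrand x y p has_integral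
      - (of_real p powr (-s)) * (u \<eta> - integral {0..\<eta>} g)) {0..\<eta>}"
    using eq by (intro has_integral_spike_finite[OF _ _ scaled, of "{0}"]) auto
  then show ?thesis1 by (rule has_integral_integrable)
  have "norm (integral {0..\<eta>} (beta_integrand x y p)) =
      p powr (- Re s) * norm (u \<eta> - integral {0..\<eta>} g)"
    unfolding integral_unique[OF main] using assms by (simp add: norm_mult norm_of_real_powr)
  also have "\<dots> \<le> p powr (- Re s) * (2 * M * \<eta> powr \<kappa> + M * N * (\<eta> powr \<kappa> / \<kappa>))"
    using assms norm_u[of \<eta>] norm_int_g
    by (intro mult_left_mono order_trans[OF norm_triangle_ineq4 add_mono]) auto
  also have "\<dots> = M * p powr (- Re s) * tail_const x y * \<eta> powr Re (x + s)"
    by (simp add: tail_const_def N_def \<kappa>_def algebra_simps add_divide_distrib)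
  finally show ?thesis2 .
qed

lemma beta_integrand_swap: "beta_integrand x y p (1 - t) = beta_integrand y x p t"
  by (simp add: beta_integrand_def beta_weight_swap mult.commute)

lemma has_integral_beta_integrand_reflect:
  assumes "(beta_integrand y x p has_integral i) {a..b}"
  shows "(beta_integrand x y p has_integral i) {1 - b..1 - a}"
  using has_integral_reflect_Icc[OF assms] by (simp add: beta_integrand_swap)

text \<open>The reflection of \<open>t\<close> to \<open>1 - t\<close> exchanges \<open>x\<close>
  and \<open>y\<close>, so the estimate at the right end is the one at the left end with swapped
  parameters. In between the integrand is continuous.\<close>

lemma beta_integrand_tails:
  assumes "p > 0" "Re x > 0" "Re y > 0" "0 < \<eta>" "\<eta> \<le> 1 / 4"
  shows "beta_integrand x y p integrable_on {0..1}"
    and "norm (integral {0..1} (beta_integrand x y p) - integral {\<eta>..1 - \<eta>} (beta_integrand x y p))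
      \<le> M * p powr (- Re s) *
        (tail_const x y * \<eta> powr Re (x + s) + tail_const y x * \<eta> powr Re (y + s))"
proof -
  let ?f = "beta_integrand x y p"
  have 1: "(?f has_integral integral {0..\<eta>} ?f) {0..\<eta>}"
    by (intro integrable_integral end_integral assms)
  have 2: "(?f has_integral integral {\<eta>..1 - \<eta>} ?f) {\<eta>..1 - \<eta>}"
    by (intro integrable_integral integrable_continuous_real continuous_on_beta_integrand)
       (use assms in auto)
  have 3: "(?f has_integral integral {0..\<eta>} (beta_integrand y x p)) {1 - \<eta>..1 - 0}"
    by (intro has_integral_beta_integrand_reflect integrable_integral end_integral assms)
  have "(?f has_integral integral {0..\<eta>} ?f + integral {\<eta>..1 - \<eta>} ?f +
      integral {0..\<eta>} (beta_integrand y x p)) {0..1}"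
    using assms 3 by (intro has_integral_combine[OF _ _ has_integral_combine[OF _ _ 1 2]]) auto
  note total = this
  show "?f integrable_on {0..1}" using total by (rule has_integral_integrable)
  have "norm (integral {0..1} ?f - integral {\<eta>..1 - \<eta>} ?f)
      = norm (integral {0..\<eta>} ?f + integral {0..\<eta>} (beta_integrand y x p))"
    using integral_unique[OF total] by simp
  also have "\<dots> \<le> M * p powr (- Re s) * tail_const x y * \<eta> powr Re (x + s)
      + M * p powr (- Re s) * tail_const y x * \<eta> powr Re (y + s)"
    by (intro order_trans[OF norm_triangle_ineq add_mono] end_integral assms)
  finally show "norm (integral {0..1} ?f - integral {\<eta>..1 - \<eta>} ?f) \<le> M * p powr (- Re s) *
        (tail_const x y * \<eta> powr Re (x + s) + tail_const y x * \<eta> powr Re (y + s))"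
    by (simp add: algebra_simps)
qed

end

section \<open>The primitive of the Mellin integrand and its derivative\<close>

lemma tendsto_integral_inner_Icc:
  fixes f :: "real \<Rightarrow> 'a::banach"
  assumes "f integrable_on {a..b}" "a < b" "\<epsilon> \<longlonglongrightarrow> 0" "\<And>n. 0 < \<epsilon> n \<and> \<epsilon> n \<le> (b - a) / 2"
  shows "(\<lambda>n. integral {a + \<epsilon> n..b - \<epsilon> n} f) \<longlonglongrightarrow> integral {a..b} f"
proof -
  let ?F = "\<lambda>t. integral {a..t} f"
  have F: "continuous_on {a..b} ?F"
    using assms(1) by (rule indefinite_integral_continuous_1)
  have ab: "a + \<epsilon> n \<in> {a..b} \<and> b - \<epsilon> n \<in> {a..b} \<and> a + \<epsilon> n \<le> b - \<epsilon> n" for n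
    using assms(2) assms(4)[of n] by (auto simp: field_simps)
  have "(\<lambda>n. ?F (b - \<epsilon> n) - ?F (a + \<epsilon> n)) \<longlonglongrightarrow> ?F b - ?F a"
  proof (intro tendsto_diff)
    have "(\<lambda>n. b - \<epsilon> n) \<longlonglongrightarrow> b - 0" by (intro tendsto_intros assms)
    then show "(\<lambda>n. ?F (b - \<epsilon> n)) \<longlonglongrightarrow> ?F b"
      using ab assms(2) by (intro continuous_on_tendsto_compose[OF F]) auto
    have "(\<lambda>n. a + \<epsilon> n) \<longlonglongrightarrow> a + 0" by (intro tendsto_intros assms)
    then show "(\<lambda>n. ?F (a + \<epsilon> n)) \<longlonglongrightarrow> ?F a"
      using ab assms(2) by (intro continuous_on_tendsto_compose[OF F]) auto
  qed
  moreover have "?F (b - \<epsilon> n) - ?F (a + \<epsilon> n) = integral {a + \<epsilon> n..b - \<epsilon> n} f" for n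
  proof -
    have "f integrable_on {a..b - \<epsilon> n}"
      using assms(1) by (rule integrable_on_subinterval) (use ab[of n] in auto)
    then have "?F (a + \<epsilon> n) + integral {a + \<epsilon> n..b - \<epsilon> n} f = ?F (b - \<epsilon> n)"
      using ab[of n] by (intro Henstock_Kurzweil_Integration.integral_combine) auto
    then show ?thesis by (simp add: algebra_simps)
  qed
  ultimately show ?thesis by simp
qed

context mellin_kernel
begin

text \<open>Formally the integral over \<open>p\<close> in \<open>{0..P}\<close> of
  \<open>p powr (s - 1)\<close> times the generalized beta integral, with the order of integration
  exchanged: for fixed \<open>t\<close> the substitution \<open>u = p / (t * (1 - t))\<close> yields
  \<open>(t * (1 - t)) powr s * G (P / (t * (1 - t)))\<close>.\<close>

definition beta_primitive :: "complex \<Rightarrow> complex \<Rightarrow> real \<Rightarrow> complex" where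
  "beta_primitive x y P = integral {0..1} (\<lambda>t. beta_weight (x + s) (y + s) t * G (P / (t * (1 - t))))"

lemma absolutely_integrable_beta_primitive:
  assumes "Re x > 0" "Re y > 0" "P > 0"
  shows "(\<lambda>t. beta_weight (x + s) (y + s) t * G (P / (t * (1 - t)))) absolutely_integrable_on {0..1}"
proof (rule absolutely_integrable_on_Icc_if_bounded)
  show "continuous_on {0<..<1} (\<lambda>t. beta_weight (x + s) (y + s) t * G (P / (t * (1 - t))))"
    using assms by (intro continuous_on_mult continuous_on_beta_weight continuous_on_quotient cont_G) auto
  show "(\<lambda>t. t powr (Re (x + s) - 1) * (1 - t) powr (Re (y + s) - 1) * M) integrable_on {0..1}"
    using assms Re_s by (intro integrable_on_mult_left integrable_Beta') auto
  show "norm (beta_weight (x + s) (y + s) t * G (P / (t * (1 - t))))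
      \<le> t powr (Re (x + s) - 1) * (1 - t) powr (Re (y + s) - 1) * M" if "t \<in> {0<..<1}" for t
    using that assms by (auto simp: norm_mult norm_beta_weight intro!: mult_left_mono bound_G)
qed

lemma norm_beta_primitive_le:
  assumes "Re x > 0" "Re y > 0" "P > 0"
  shows "norm (beta_primitive x y P) \<le> M * Beta (Re (x + s)) (Re (y + s))"
proof -
  let ?h = "\<lambda>t. t powr (Re (x + s) - 1) * (1 - t) powr (Re (y + s) - 1) * M"
  have h: "(?h has_integral Beta (Re (x + s)) (Re (y + s)) * M) {0..1}"
    using assms Re_s by (intro has_integral_mult_left has_integral_Beta_real) auto
  have "norm (beta_primitive x y P) \<le> integral {0..1} ?h"
    unfolding beta_primitive_def
  proof (rule integral_norm_bound_integral)
    show "norm (beta_weight (x + s) (y + s) t * G (P / (t * (1 - t)))) \<le> ?h t" if "t \<in> {0..1}" for t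
    proof (cases "t \<in> {0<..<1}")
      case True
      then show ?thesis
        using that assms by (auto simp: norm_mult norm_beta_weight intro!: mult_left_mono bound_G)
    next
      case False
      then have "t = 0 \<or> t = 1" using that by auto
      then show ?thesis by (auto simp: beta_weight_def)
    qed
  qed (use h absolutely_integrable_beta_primitive[OF assms] in
      \<open>auto intro: has_integral_integrable set_lebesgue_integral_eq_integral(1)\<close>)
  then show ?thesis unfolding integral_unique[OF h] by (simp only: mult.commute)
qed

text \<open>Dominated convergence with \<open>M\<close> times the modulus of the weight as majorant.
  Leaving the pointwise limit \<open>l\<close> open serves both ends, \<open>P\<close> tending to
  \<open>0\<close> and to infinity.\<close>

lemma beta_primitive_tendsto:
  assumes "Re x > 0" "Re y > 0" "\<And>n. X n > 0"
    and lim: "\<And>t. t \<in> {0<..<1} \<Longrightarrow> (\<lambda>n. G (X n / (t * (1 - t)))) \<longlonglongrightarrow> l"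
  shows "(\<lambda>n. beta_primitive x y (X n)) \<longlonglongrightarrow> l * Beta (x + s) (y + s)"
proof -
  let ?h = "\<lambda>t. t powr (Re (x + s) - 1) * (1 - t) powr (Re (y + s) - 1) * M"
  \<comment> \<open>At the two end points the weight and the majorant are \<open>0\<close>, because
    \<open>0 powr z = 0\<close>.\<close>
  have bd: "t = 0 \<or> t = 1" if "t \<in> {0..1} - {0<..<1}" for t :: real using that by auto
  have "(\<lambda>n. beta_primitive x y (X n)) \<longlonglongrightarrow> integral {0..1} (\<lambda>t. l * beta_weight (x + s) (y + s) t)"
    unfolding beta_primitive_def
  proof (rule dominated_convergence)
    show "(\<lambda>t. beta_weight (x + s) (y + s) t * G (X n / (t * (1 - t)))) integrable_on {0..1}" for n
      by (intro set_lebesgue_integral_eq_integral(1) absolutely_integrable_beta_primitive assms)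
    show "?h integrable_on {0..1}"
      using assms Re_s by (intro integrable_on_mult_left integrable_Beta') auto
    show "norm (beta_weight (x + s) (y + s) t * G (X n / (t * (1 - t)))) \<le> ?h t"
      if "t \<in> {0..1}" for n t
    proof (cases "t \<in> {0<..<1}")
      case True
      then show ?thesis
        using that assms by (auto simp: norm_mult norm_beta_weight intro!: mult_left_mono bound_G)
    next
      case False
      then show ?thesis using bd[of t] that by (auto simp: beta_weight_def)
    qed
    show "(\<lambda>n. beta_weight (x + s) (y + s) t * G (X n / (t * (1 - t)))) \<longlonglongrightarrow>
        l * beta_weight (x + s) (y + s) t" if "t \<in> {0..1}" for t
    proof (cases "t \<in> {0<..<1}")
      case True
      then show ?thesis
        using tendsto_mult_left[OF lim[OF True], of "beta_weight (x + s) (y + s) t"]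
        by (simp only: mult.commute[of l])
    next
      case False
      then show ?thesis using bd[of t] that by (auto simp: beta_weight_def)
    qed
  qed
  moreover have I: "((\<lambda>t. l * beta_weight (x + s) (y + s) t) has_integral l * Beta (x + s) (y + s)) {0..1}"
    unfolding beta_weight_def using assms Re_s
    by (intro has_integral_mult_right has_integral_Beta_complex) auto
  ultimately show ?thesis unfolding integral_unique[OF I] by simp
qed

lemma beta_primitive_at_0:
  assumes "Re x > 0" "Re y > 0"
  shows "(beta_primitive x y \<longlongrightarrow> 0) (at_right 0)"
proof (rule tendsto_at_right_sequentially[of 0 1])
  fix X :: "nat \<Rightarrow> real" assume X: "\<And>n. 0 < X n" "X \<longlonglongrightarrow> 0"
  have "(\<lambda>n. beta_primitive x y (X n)) \<longlonglongrightarrow> 0 * Beta (x + s) (y + s)"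
  proof (rule beta_primitive_tendsto)
    fix t :: real assume t: "t \<in> {0<..<1}"
    have "(\<lambda>n. X n / (t * (1 - t))) \<longlonglongrightarrow> 0 / (t * (1 - t))"
      using t by (intro tendsto_intros X) auto
    then have "filterlim (\<lambda>n. X n / (t * (1 - t))) (at_right 0) sequentially"
      using t X by (auto simp: filterlim_at less_imp_neq[symmetric])
    then show "(\<lambda>n. G (X n / (t * (1 - t)))) \<longlonglongrightarrow> 0"
      by (rule filterlim_compose[OF G_at_0])
  qed (use assms X in auto)
  then show "(\<lambda>n. beta_primitive x y (X n)) \<longlonglongrightarrow> 0" by simp
qed simp

lemma beta_primitive_at_top:
  assumes "Re x > 0" "Re y > 0"
  shows "(beta_primitive x y \<longlongrightarrow> L * Beta (x + s) (y + s)) at_top"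
proof (rule tendsto_at_topI_sequentially)
  fix X :: "nat \<Rightarrow> real" assume X: "filterlim X at_top sequentially"
  then have "eventually (\<lambda>n. X n > 0) sequentially" by (simp add: filterlim_at_top_dense)
  \<comment> \<open>A sequence tending to infinity may start with nonpositive terms; they are
    dropped by an index shift.\<close>
  then obtain N where N: "\<And>n. X (n + N) > 0"
    using eventually_sequentially le_add2 by metis
  have "(\<lambda>n. beta_primitive x y (X (n + N))) \<longlonglongrightarrow> L * Beta (x + s) (y + s)"
  proof (rule beta_primitive_tendsto)
    fix t :: real assume t: "t \<in> {0<..<1}"
    have "filterlim (\<lambda>n. X (n + N)) at_top sequentially"
      using X by (rule filterlim_compose) (rule filterlim_add_const_nat_at_top)
    then have "filterlim (\<lambda>n. inverse (t * (1 - t)) * X (n + N)) at_top sequentially"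
      using t by (intro filterlim_tendsto_pos_mult_at_top[OF tendsto_const]) auto
    then show "(\<lambda>n. G (X (n + N) / (t * (1 - t)))) \<longlonglongrightarrow> L"
      using filterlim_compose[OF G_at_top] by (simp add: divide_inverse mult.commute)
  qed (use assms N in auto)
  then show "(\<lambda>n. beta_primitive x y (X n)) \<longlonglongrightarrow> L * Beta (x + s) (y + s)"
    by (rule LIMSEQ_offset)
qed


text \<open>Away from the end points everything is jointly continuous and the classical Leibniz rule
  applies. Differentiating \<open>G (P / (t * (1 - t)))\<close> in \<open>P\<close> releases the
  power \<open>-s\<close> of \<open>t * (1 - t)\<close>, which lowers \<open>x + s\<close> and
  \<open>y + s\<close> back to \<open>x\<close> and \<open>y\<close>.\<close>

lemma truncated_primitive_has_vector_derivative:
  assumes "Re x > 0" "Re y > 0" "P > 0" "0 < \<epsilon>" "\<epsilon> < 1 / 2"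
  shows "((\<lambda>P. integral {\<epsilon>..1 - \<epsilon>} (\<lambda>t. beta_weight (x + s) (y + s) t * G (P / (t * (1 - t)))))
    has_vector_derivative
      of_real P powr (s - 1) * integral {\<epsilon>..1 - \<epsilon>} (beta_integrand x y P)) (at P)"
proof -
  let ?D = "\<lambda>P t. of_real P powr (s - 1) * beta_integrand x y P t"
  have sub: "{\<epsilon>..1 - \<epsilon>} \<subseteq> {0<..<1}" using assms by auto
  have pow: "complex_of_real r powr (z + s - 1) * of_real r powr (- (s - 1)) = of_real r powr (z - 1) * of_real r"
    if "r > 0" for r z
  proof -
    have "complex_of_real r powr (z + s - 1) * of_real r powr (- (s - 1)) = of_real r powr z"
      by (simp flip: powr_add)
    then show ?thesis using powr_minus_one_mult[OF that, of z] by simp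
  qed
  have "((\<lambda>P. integral (cbox \<epsilon> (1 - \<epsilon>)) (\<lambda>t. beta_weight (x + s) (y + s) t * G (P / (t * (1 - t)))))
    has_vector_derivative integral (cbox \<epsilon> (1 - \<epsilon>)) (?D P)) (at P within {0<..})"
  proof (rule leibniz_rule_vector_derivative)
    fix P t :: real assume P: "P \<in> {0<..}" and "t \<in> cbox \<epsilon> (1 - \<epsilon>)"
    then have t: "0 < t" "t < 1" using sub by auto
    have "((\<lambda>P. P / (t * (1 - t))) has_vector_derivative 1 / (t * (1 - t))) (at P)"
      using t by (auto intro!: derivative_eq_intros simp flip: has_real_derivative_iff_has_vector_derivative)
    then have "(G \<circ> (\<lambda>P. P / (t * (1 - t))) has_vector_derivative
        (1 / (t * (1 - t))) *\<^sub>R (of_real (P / (t * (1 - t))) powr (s - 1) * e (P / (t * (1 - t))))) (at P)"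
      using t P by (intro vector_diff_chain_at deriv_G) auto
    from has_vector_derivative_mult_right[OF this, of "beta_weight (x + s) (y + s) t"]
    have "((\<lambda>P. beta_weight (x + s) (y + s) t * G (P / (t * (1 - t)))) has_vector_derivative
       beta_weight (x + s) (y + s) t *
        (of_real (1 / (t * (1 - t))) * (of_real (P / (t * (1 - t))) powr (s - 1) * e (P / (t * (1 - t)))))) (at P)"
      by (simp only: o_def scaleR_conv_of_real)
    moreover have "beta_weight (x + s) (y + s) t *
        (of_real (1 / (t * (1 - t))) * (of_real (P / (t * (1 - t))) powr (s - 1) * e (P / (t * (1 - t)))))
       = ?D P t"
    proof -
      have *: "A * B * (1 / (t' * u) * (Q * A2 * B2 * E)) = Q * (W1 * W2 * E)"
        if "A * A2 = W1 * t'" "B * B2 = W2 * u" "t' \<noteq> 0" "u \<noteq> 0" for A B t' u Q A2 B2 E W1 W2 :: complex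
      proof -
        have "A * B * (1 / (t' * u) * (Q * A2 * B2 * E)) = (A * A2) * (B * B2) * Q * E / (t' * u)"
          by simp
        then show ?thesis unfolding that(1,2) using that(3,4) by simp
      qed
      have q: "of_real (P / (t * (1 - t))) powr (s - 1) =
          complex_of_real P powr (s - 1) * of_real t powr (- (s - 1)) * of_real (1 - t) powr (- (s - 1))"
        using t P by (intro of_real_powr_quotient) auto
      have ne: "complex_of_real t \<noteq> 0" "complex_of_real (1 - t) \<noteq> 0"
        unfolding of_real_eq_0_iff using t by auto
      show ?thesis
        unfolding beta_integrand_def beta_weight_def q
        unfolding of_real_divide of_real_mult of_real_1
        by (rule *[OF pow pow ne]) (use t in auto)
    qed
    ultimately show "((\<lambda>P. beta_weight (x + s) (y + s) t * G (P / (t * (1 - t)))) has_vector_derivative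
       ?D P t) (at P within {0<..})"
      by (simp add: has_vector_derivative_at_within)
  next
    fix P :: real assume "P \<in> {0<..}"
    then show "(\<lambda>t. beta_weight (x + s) (y + s) t * G (P / (t * (1 - t)))) integrable_on cbox \<epsilon> (1 - \<epsilon>)"
      unfolding cbox_interval using sub
      by (intro integrable_continuous_real continuous_on_mult continuous_on_beta_weight
          continuous_on_quotient cont_G) auto
  next
    have "continuous_on ({0<..} \<times> cbox \<epsilon> (1 - \<epsilon>)) (\<lambda>z. complex_of_real (fst z) powr (s - 1))"
      by (intro continuous_intros continuous_on_powr_complex) auto
    moreover have "continuous_on ({0<..} \<times> cbox \<epsilon> (1 - \<epsilon>)) (\<lambda>z. beta_weight x y (snd z))"
      by (rule continuous_on_compose2[OF continuous_on_beta_weight[OF sub]])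
         (auto intro: continuous_intros)
    moreover have "continuous_on ({0<..} \<times> cbox \<epsilon> (1 - \<epsilon>)) (\<lambda>z. e (fst z / (snd z * (1 - snd z))))"
    proof (rule continuous_on_compose2[OF cont_e])
      have "snd z \<noteq> 0 \<and> 1 - snd z \<noteq> 0" if "z \<in> {0<..} \<times> cbox \<epsilon> (1 - \<epsilon>)" for z :: "real \<times> real"
        using that assms by auto
      then show "continuous_on ({0<..} \<times> cbox \<epsilon> (1 - \<epsilon>)) (\<lambda>z. fst z / (snd z * (1 - snd z)))"
        by (intro continuous_intros) auto
    qed (use assms in auto)
    ultimately show "continuous_on ({0<..} \<times> cbox \<epsilon> (1 - \<epsilon>)) (\<lambda>(P, t). ?D P t)"
      unfolding beta_integrand_def case_prod_unfold by (intro continuous_on_mult)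
  qed (use assms in auto)
  then show ?thesis
    using assms by (simp add: at_within_open[of _ "{0<..}"])
qed

text \<open>The truncated primitives converge pointwise and their derivatives converge uniformly on
  \<open>{P / 2<..}\<close>: in the tail bound the powers of the variable collapse to
  \<open>1 / Q\<close>, which is at most \<open>2 / P\<close> there.\<close>

lemma beta_primitive_has_vector_derivative:
  assumes "Re x > 0" "Re y > 0" "P > 0"
  shows "(beta_primitive x y has_vector_derivative
      of_real P powr (s - 1) * integral {0..1} (beta_integrand x y P)) (at P)"
proof -
  \<comment> \<open>The offset \<open>4\<close> keeps every truncation within the range
    \<open>{0<..1 / 4}\<close> of the tail estimate.\<close>
  define \<epsilon> where "\<epsilon> = (\<lambda>n. 1 / (real n + 4))"
  have \<epsilon>: "0 < \<epsilon> n" "\<epsilon> n \<le> 1 / 4" for n by (auto simp: \<epsilon>_def field_simps)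
  have \<epsilon>_lim: "\<epsilon> \<longlonglongrightarrow> 0" unfolding \<epsilon>_def by real_asymp
  define f where "f = (\<lambda>n P. integral {\<epsilon> n..1 - \<epsilon> n}
    (\<lambda>t. beta_weight (x + s) (y + s) t * G (P / (t * (1 - t)))))"
  define d where "d = (\<lambda>n P. of_real P powr (s - 1) * integral {\<epsilon> n..1 - \<epsilon> n} (beta_integrand x y P))"
  define d' where "d' = (\<lambda>P. of_real P powr (s - 1) * integral {0..1} (beta_integrand x y P))"
  define S where "S = {P / 2<..}"
  define \<delta> where "\<delta> = (\<lambda>n. tail_const x y * \<epsilon> n powr Re (x + s) + tail_const y x * \<epsilon> n powr Re (y + s))"
  have pos: "Q > 0" if "Q \<in> S" for Q using that assms by (simp add: S_def)
  have lim: "(\<lambda>n. f n Q) \<longlonglongrightarrow> beta_primitive x y Q" if "Q \<in> S" for Q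
  proof -
    have "\<epsilon> n \<le> 1 / 2" for n using \<epsilon>(2)[of n] by simp
    then show ?thesis
      unfolding f_def beta_primitive_def
      using tendsto_integral_inner_Icc[OF set_lebesgue_integral_eq_integral(1)[OF
            absolutely_integrable_beta_primitive[OF assms(1,2) pos[OF that]]] _ \<epsilon>_lim] \<epsilon>(1)
      by simp
  qed
  have "\<exists>g. \<forall>Q\<in>S. (\<lambda>n. f n Q) \<longlonglongrightarrow> g Q \<and> (g has_derivative (\<lambda>h. h *\<^sub>R d' Q)) (at Q within S)"
  proof (rule has_derivative_sequence)
    show "convex S" by (simp add: S_def)
    show "P \<in> S" using assms by (simp add: S_def)
    then show "(\<lambda>n. f n P) \<longlonglongrightarrow> beta_primitive x y P" by (rule lim)
    fix n Q assume Q: "Q \<in> S"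
    have "(f n has_vector_derivative d n Q) (at Q)"
      unfolding f_def d_def using \<epsilon>[of n] pos[OF Q] assms
      by (intro truncated_primitive_has_vector_derivative) auto
    then show "(f n has_derivative (\<lambda>h. h *\<^sub>R d n Q)) (at Q within S)"
      by (simp add: has_vector_derivative_def has_derivative_at_withinI)
  next
    fix r :: real assume "r > 0"
    have \<epsilon>_powr: "(\<lambda>n. \<epsilon> n powr k) \<longlonglongrightarrow> 0" if "k > 0" for k
      unfolding \<epsilon>_def using that by real_asymp
    have "(\<lambda>n. 2 / P * M * \<delta> n) \<longlonglongrightarrow> 2 / P * M * (tail_const x y * 0 + tail_const y x * 0)"
      unfolding \<delta>_def using assms Re_s by (intro tendsto_intros \<epsilon>_powr) auto
    then have "(\<lambda>n. 2 / P * M * \<delta> n) \<longlonglongrightarrow> 0" by simp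
    then have "eventually (\<lambda>n. 2 / P * M * \<delta> n < r) sequentially"
      using \<open>r > 0\<close> by (rule order_tendstoD)
    then show "eventually (\<lambda>n. \<forall>Q\<in>S. \<forall>h. norm (h *\<^sub>R d n Q - h *\<^sub>R d' Q) \<le> r * norm h) sequentially"
    proof eventually_elim
      case (elim n)
      show ?case
      proof (intro ballI allI)
        fix Q h assume Q: "Q \<in> S"
        have "norm (d n Q - d' Q) = Q powr (Re s - 1) *
            norm (integral {0..1} (beta_integrand x y Q) - integral {\<epsilon> n..1 - \<epsilon> n} (beta_integrand x y Q))"
          using pos[OF Q]
          by (simp add: d_def d'_def norm_mult norm_minus_commute norm_of_real_powr flip: right_diff_distrib)
        also have "\<dots> \<le> Q powr (Re s - 1) * (M * Q powr (- Re s) * \<delta> n)"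
          unfolding \<delta>_def using pos[OF Q] assms \<epsilon> by (intro mult_left_mono beta_integrand_tails) auto
        also have "\<dots> = (Q powr (Re s - 1) * Q powr (- Re s)) * (M * \<delta> n)" by simp
        also have "Q powr (Re s - 1) * Q powr (- Re s) = 1 / Q"
          using pos[OF Q] by (simp add: powr_diff powr_minus divide_simps)
        also have "1 / Q * (M * \<delta> n) \<le> 2 / P * (M * \<delta> n)"
        proof (rule mult_right_mono)
          show "1 / Q \<le> 2 / P" using Q assms by (simp add: S_def field_simps)
          have "tail_const x y \<ge> 0" "tail_const y x \<ge> 0"
            using assms Re_s by (auto simp: tail_const_def)
          then show "0 \<le> M * \<delta> n" using M_nonneg by (simp add: \<delta>_def)
        qed
        also have "\<dots> \<le> r" using elim by (simp add: mult.assoc)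
        finally have "norm (d n Q - d' Q) \<le> r" .
        then show "norm (h *\<^sub>R d n Q - h *\<^sub>R d' Q) \<le> r * norm h"
          by (simp add: mult.commute[of r] mult_left_mono flip: scaleR_diff_right)
      qed
    qed
  qed
  then obtain g where g: "\<And>Q. Q \<in> S \<Longrightarrow> (\<lambda>n. f n Q) \<longlonglongrightarrow> g Q"
    "\<And>Q. Q \<in> S \<Longrightarrow> (g has_derivative (\<lambda>h. h *\<^sub>R d' Q)) (at Q within S)" by blast
  have eq: "g Q = beta_primitive x y Q" if "Q \<in> S" for Q
    using LIMSEQ_unique[OF g(1) lim] that by simp
  have PS: "P \<in> S" "open S" using assms by (auto simp: S_def)
  have "(g has_vector_derivative d' P) (at P)"
    using g(2)[OF PS(1)] by (simp add: has_vector_derivative_def at_within_open[OF PS])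
  then show ?thesis
    unfolding d'_def using has_vector_derivative_transform_within_open[OF _ PS(2,1) eq] by simp
qed

end

text \<open>Hake's theorem at infinity, and its converse below.\<close>
lemma has_integral_Ici_if_tendsto:
  fixes f :: "real \<Rightarrow> complex"
  assumes f: "\<And>P. P > 0 \<Longrightarrow> (f has_integral H P) {0..P}" and H: "(H \<longlongrightarrow> L) at_top"
  shows "(f has_integral L) {0..}"
  unfolding has_integral_alt'
proof (intro conjI allI impI)
  fix a b :: real
  have "f integrable_on {0..max b 1}"
    by (rule has_integral_integrable[OF f]) auto
  then have "f integrable_on {max 0 a..b}"
    by (rule integrable_on_subinterval) auto
  moreover have "{0..} \<inter> cbox a b = {max 0 a..b}" by auto
  ultimately have "f integrable_on ({0..} \<inter> cbox a b)" by simp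
  then show "(\<lambda>x. if x \<in> {0..} then f x else 0) integrable_on cbox a b"
    by (simp only: integrable_restrict_Int)
next
  fix r :: real assume "r > 0"
  then have "eventually (\<lambda>P. dist (H P) L < r) at_top" using H by (simp add: tendstoD)
  then obtain B where B: "\<And>P. P \<ge> B \<Longrightarrow> dist (H P) L < r"
    by (auto simp: eventually_at_top_linorder)
  show "\<exists>B>0. \<forall>a b. ball 0 B \<subseteq> cbox a b \<longrightarrow>
    norm (integral (cbox a b) (\<lambda>x. if x \<in> {0..} then f x else 0) - L) < r"
  proof (intro exI[of _ "max B 1"] conjI allI impI)
    fix a b :: real assume sub: "ball 0 (max B 1) \<subseteq> cbox a b"
    have a: "a \<le> 0" using subsetD[OF sub, of 0] by simp
    have b: "b \<ge> max B 1"
    proof (rule ccontr)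
      assume "\<not> b \<ge> max B 1"
      \<comment> \<open>Otherwise the midpoint of \<open>max b 0\<close> and \<open>max B 1\<close>
        lies in the ball but beyond \<open>b\<close>.\<close>
      then have m: "(max b 0 + max B 1) / 2 \<in> ball 0 (max B 1)" "(max b 0 + max B 1) / 2 > b"
        by (auto simp: field_simps max_def split: if_splits)
      show False using subsetD[OF sub m(1)] m(2) unfolding cbox_interval atLeastAtMost_iff by linarith
    qed
    have "{0..} \<inter> cbox a b = {0..b}" using a by auto
    then have "integral (cbox a b) (\<lambda>x. if x \<in> {0..} then f x else 0) = H b"
      using b integral_unique[OF f[of b]] by (simp only: integral_restrict_Int)
    then show "norm (integral (cbox a b) (\<lambda>x. if x \<in> {0..} then f x else 0) - L) < r"
      using B[of b] b by (simp add: dist_norm)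
  qed simp
qed

lemma tendsto_integral_at_top:
  fixes f :: "real \<Rightarrow> complex"
  assumes "(f has_integral L) {0..}"
  shows "((\<lambda>P. integral {0..P} f) \<longlongrightarrow> L) at_top"
proof (rule tendstoI)
  fix r :: real assume "r > 0"
  with assms obtain B where "B > 0" and B: "\<And>a b. ball 0 B \<subseteq> cbox a b \<Longrightarrow>
    norm (integral (cbox a b) (\<lambda>x. if x \<in> {0..} then f x else 0) - L) < r"
    unfolding has_integral_alt' by meson
  show "eventually (\<lambda>P. dist (integral {0..P} f) L < r) at_top"
    using eventually_ge_at_top[of B]
  proof eventually_elim
    case (elim P)
    have "{0..} \<inter> cbox (-P) P = {0..P}" using elim \<open>B > 0\<close> by auto
    moreover have "ball 0 B \<subseteq> cbox (-P) P" using elim by auto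
    ultimately show ?case
      using B[of "-P" P] by (simp only: integral_restrict_Int dist_norm)
  qed
qed

section \<open>Linear growth in \<open>n\<close> of the generalized beta integrals\<close>

context mellin_kernel
begin

lemma tail_const_nonneg: "Re x > 0 \<Longrightarrow> tail_const x y \<ge> 0"
  using Re_s by (auto simp: tail_const_def)

lemma norm_add_of_nat_le: "norm (b + of_nat n + s) + k \<le> (norm (b + s) + k) * (real n + 1)" if "k \<ge> 1"
proof -
  have "norm (b + of_nat n + s) \<le> norm (b + s) + real n"
    using norm_triangle_ineq[of "b + s" "of_nat n"] by (simp add: add_ac)
  moreover have "real n * 1 \<le> real n * (norm (b + s) + k)"
    using that by (intro mult_left_mono) (auto simp: add_increasing)
  ultimately show ?thesis by (simp add: algebra_simps)
qed

text \<open>Adding \<open>n\<close> to \<open>b\<close> enlarges the numerator at most by the factor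
  \<open>n + 1\<close>, and the real part in the denominator does not decrease.\<close>

lemma tail_const_add_le:
  assumes "Re b > 0" "Re y > 0"
  shows "tail_const (b + of_nat n) y \<le> tail_const b y * (real n + 1)"
    and "tail_const y (b + of_nat n) \<le> tail_const y b * (real n + 1)"
proof -
  define N where "N = norm (b + s) + (norm (y + s) + 1)"
  have N: "norm (b + of_nat n + s) + (norm (y + s) + 1) \<le> N * (real n + 1)" "N \<ge> 0"
    unfolding N_def by (intro norm_add_of_nat_le) auto
  have scale: "2 + 2 * u \<le> (2 + 2 * v) * (real n + 1)" if "u \<le> v * (real n + 1)" for u v :: real
    using that by (simp add: algebra_simps)
  have "(norm (b + of_nat n + s) + (norm (y + s) + 1)) / Re (b + of_nat n + s) \<le>
      N * (real n + 1) / Re (b + s)"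
    using N assms Re_s by (intro frac_le) auto
  then have "(norm (b + of_nat n + s) + (norm (y + s) + 1)) / Re (b + of_nat n + s) \<le>
      N / Re (b + s) * (real n + 1)"
    by (simp only: times_divide_eq_left)
  from scale[OF this] show "tail_const (b + of_nat n) y \<le> tail_const b y * (real n + 1)"
    unfolding tail_const_def N_def by (simp only: times_divide_eq_right add.assoc)
  have "(norm (b + of_nat n + s) + (norm (y + s) + 1)) / Re (y + s) \<le>
      N * (real n + 1) / Re (y + s)"
    using N assms Re_s by (intro divide_right_mono) auto
  then have "(norm (b + of_nat n + s) + (norm (y + s) + 1)) / Re (y + s) \<le>
      N / Re (y + s) * (real n + 1)"
    by (simp only: times_divide_eq_left)
  from scale[OF this] show "tail_const y (b + of_nat n) \<le> tail_const y b * (real n + 1)"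
    unfolding tail_const_def N_def
    by (simp only: times_divide_eq_right add.assoc add.left_commute[of "norm (y + s)"])
qed

text \<open>Split at \<open>1 / 4\<close> and \<open>3 / 4\<close>. In the middle the shift by
  \<open>n\<close> only contributes \<open>t ^ n \<le> 1\<close>; at the ends the tail estimate with
  \<open>\<eta> = 1 / 4\<close> grows linearly through \<open>tail_const\<close>.\<close>

lemma beta_integral_linear_bound:
  assumes "Re b > 0" "Re y > 0" "0 < P1" "P1 \<le> P2"
  obtains K where "K \<ge> 0" "\<And>n P. P \<in> {P1..P2} \<Longrightarrow>
    norm (integral {0..1} (beta_integrand (b + of_nat n) y P)) \<le> K * (real n + 1)"
proof -
  \<comment> \<open>On the middle interval \<open>t * (1 - t)\<close> lies between
    \<open>1 / 8\<close> and \<open>1\<close>, so the argument of \<open>e\<close> stays in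
    \<open>{P1..8 * P2}\<close>.\<close>
  have "compact (e ` {P1..8 * P2})"
    using assms by (intro compact_continuous_image continuous_on_subset[OF cont_e]) auto
  then obtain E where E: "\<And>v. v \<in> {P1..8 * P2} \<Longrightarrow> norm (e v) \<le> E"
    by (meson bounded_iff compact_imp_bounded imageI)
  have "compact (beta_weight b y ` {1/4..3/4})"
    by (intro compact_continuous_image continuous_on_beta_weight) auto
  then obtain W where W: "\<And>t. t \<in> {1/4..3/4} \<Longrightarrow> norm (beta_weight b y t) \<le> W"
    by (meson bounded_iff compact_imp_bounded imageI)
  have E0: "E \<ge> 0" by (rule order_trans[OF norm_ge_zero E[of P1]]) (use assms in auto)
  have W0: "W \<ge> 0" by (rule order_trans[OF norm_ge_zero W[of "1/2"]]) auto
  define A where "A = M * P1 powr (- Re s) * (tail_const b y + tail_const y b)"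
  have A0: "A \<ge> 0"
    unfolding A_def using M_nonneg tail_const_nonneg assms by (intro mult_nonneg_nonneg add_nonneg_nonneg) auto
  show ?thesis
  proof (rule that[of "A + W * E"])
    show "0 \<le> A + W * E" using A0 E0 W0 by simp
  next
    fix n P assume P: "P \<in> {P1..P2}"
    let ?f = "beta_integrand (b + of_nat n) y P" and ?x = "b + of_nat n"
    have P0: "P > 0" and x0: "Re ?x > 0" using P assms by (auto intro: add_pos_nonneg)
    have mid: "norm (integral {1/4..3/4} ?f) \<le> W * E * (3/4 - 1/4)"
    proof (rule integral_bound)
      show "continuous_on {1/4..3/4} ?f" using P0 by (intro continuous_on_beta_integrand) auto
      fix t :: real assume t: "t \<in> {1/4..3/4}"
      have "beta_weight ?x y t = of_real t ^ n * beta_weight b y t"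
        using t by (simp add: beta_weight_def powr_add powr_diff)
      moreover have "t ^ n \<le> 1" using t by (intro power_le_one) auto
      ultimately have w: "norm (beta_weight ?x y t) \<le> W"
        using mult_mono[of "t ^ n" 1 "norm (beta_weight b y t)" W] W[OF t] t
        by (simp add: norm_mult norm_power)
      have "P / (t * (1 - t)) \<in> {P1..8 * P2}"
      proof -
        have q: "0 < t * (1 - t)" "t * (1 - t) \<le> 1" using t by (auto intro: mult_le_one)
        have "0 \<le> (t - 1 / 4) * (3 / 4 - t)" using t by (intro mult_nonneg_nonneg) auto
        then have "1 / 8 \<le> t * (1 - t)" by (simp add: field_simps)
        then have "P / (t * (1 - t)) \<le> P / (1 / 8)"
          using P0 q by (intro divide_left_mono) auto
        moreover have "P \<le> P / (t * (1 - t))"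
          using mult_left_mono[OF q(2), of P] P0 q(1) by (simp only: pos_le_divide_eq) simp
        ultimately show ?thesis using P by simp
      qed
      from mult_mono[OF w E[OF this]] W0
      show "norm (?f t) \<le> W * E" by (simp add: beta_integrand_def norm_mult)
    qed simp
    have p14: "(1/4) powr r \<le> 1" if "r > 0" for r :: real
      using that powr_mono'[of 0 r "1/4"] by simp
    have tails: "norm (integral {0..1} ?f - integral {1/4..3/4} ?f)
        \<le> M * P powr (- Re s) * (tail_const ?x y * (1/4) powr Re (?x + s) + tail_const y ?x * (1/4) powr Re (y + s))"
      using beta_integrand_tails(2)[of P ?x y "1/4"] P0 x0 assms by simp
    also have "\<dots> \<le> M * P1 powr (- Re s) * (tail_const b y * (real n + 1) * 1 + tail_const y b * (real n + 1) * 1)"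
      using M_nonneg P assms Re_s x0 tail_const_nonneg
      by (intro mult_mono add_mono p14 tail_const_add_le powr_mono2' mult_nonneg_nonneg add_nonneg_nonneg) auto
    also have "\<dots> = A * (real n + 1)" by (simp add: A_def algebra_simps)
    finally have "norm (integral {0..1} ?f - integral {1/4..3/4} ?f) \<le> A * (real n + 1)" .
    moreover have "W * E * (3/4 - 1/4) \<le> W * E * (real n + 1)"
      using W0 E0 by (intro mult_left_mono) auto
    ultimately have "norm (integral {0..1} ?f - integral {1/4..3/4} ?f) + norm (integral {1/4..3/4} ?f)
        \<le> A * (real n + 1) + W * E * (real n + 1)"
      using mid by linarith
    then show "norm (integral {0..1} ?f) \<le> (A + W * E) * (real n + 1)"
      using norm_triangle_sub[of "integral {0..1} ?f" "integral {1/4..3/4} ?f"]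
      by (simp add: distrib_right)
  qed
qed

end

subsection \<open>The Mellin transform of the series\<close>

text \<open>Tannery's theorem with a majorant valid for all positive arguments, so that one majorant
  serves the limits at \<open>0\<close> and at infinity.\<close>

lemma tendsto_suminf_if_dominated:
  fixes a :: "nat \<Rightarrow> real \<Rightarrow> complex"
  assumes "\<And>k. (a k \<longlongrightarrow> l k) F" "eventually (\<lambda>P. P > 0) F"
    and "\<And>k P. P > 0 \<Longrightarrow> norm (a k P) \<le> B k" "summable B" "F \<noteq> bot"
  shows "((\<lambda>P. \<Sum>k. a k P) \<longlongrightarrow> (\<Sum>k. l k)) F"
proof -
  have "eventually (\<lambda>x. True \<and> snd x > 0) ((at_top :: nat filter) \<times>\<^sub>F F)"
    by (intro eventually_prodI[where P = "\<lambda>_. True"] assms) simp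
  then have "eventually (\<lambda>(k, P). norm (a k P) \<le> B k) (at_top \<times>\<^sub>F F)"
    by eventually_elim (auto intro: assms)
  from tannerys_theorem[OF assms(1) this assms(4,5)] show ?thesis by simp
qed

context mellin_kernel
begin

text \<open>The sum \<open>H\<close> of the beta primitives is differentiated termwise: the weight
  \<open>real n + 1\<close> in the summability hypothesis matches the growth of the beta integrals.
  The primitives themselves are bounded uniformly in \<open>n\<close>, so the limits of
  \<open>H\<close> at both ends are taken termwise too; the fundamental theorem and Hake's theorem
  conclude.\<close>

lemma mellin_series:
  fixes c :: "nat \<Rightarrow> complex"
  assumes "Re b > 0" "Re y > 0" and c: "summable (\<lambda>n. norm (c n) * (real n + 1))"
  shows "((\<lambda>p. of_real p powr (s - 1) *
            (\<Sum>n. c n * integral {0..1} (beta_integrand (b + of_nat n) y p)))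
          has_integral (\<Sum>n. c n * (L * Beta (b + of_nat n + s) (y + s)))) {0..}"
proof -
  define I where "I = (\<lambda>n p. integral {0..1} (beta_integrand (b + of_nat n) y p))"
  define h where "h = (\<lambda>n p. c n * beta_primitive (b + of_nat n) y p)"
  define d where "d = (\<lambda>n p. c n * (of_real p powr (s - 1) * I n p))"
  define H where "H = (\<lambda>p. \<Sum>n. h n p)"
  \<comment> \<open>The bound for index \<open>0\<close>; it works for all \<open>n\<close> because
    \<open>Beta\<close> decreases in its first argument.\<close>
  define Bd where "Bd = M * Beta (Re (b + s)) (Re (y + s))"
  have bn: "Re (b + of_nat n) > 0" for n using assms by (simp add: add_pos_nonneg)
  have sum_c: "summable (\<lambda>n. norm (c n))"
  proof (rule summable_comparison_test'[OF c])
    show "norm (norm (c n)) \<le> norm (c n) * (real n + 1)" if "n \<ge> 0" for n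
      using mult_left_mono[of 1 "real n + 1" "norm (c n)"] by simp
  qed
  have h_le: "norm (h n p) \<le> norm (c n) * Bd" if "p > 0" for n p
  proof -
    have "norm (beta_primitive (b + of_nat n) y p) \<le> M * Beta (Re (b + of_nat n + s)) (Re (y + s))"
      using that assms bn by (intro norm_beta_primitive_le) auto
    also have "\<dots> \<le> Bd"
      unfolding Bd_def using M_nonneg assms Re_s by (intro mult_left_mono Beta_real_mono) auto
    finally show ?thesis by (simp add: h_def norm_mult mult_left_mono)
  qed
  have sum_Bd: "summable (\<lambda>n. norm (c n) * Bd)"
    using sum_c by (rule summable_mult2)
  have H0: "(H \<longlongrightarrow> 0) (at_right 0)"
  proof -
    have "(H \<longlongrightarrow> (\<Sum>n. c n * 0)) (at_right 0)"
      unfolding H_def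
    proof (rule tendsto_suminf_if_dominated[OF _ _ h_le sum_Bd])
      show "(h k \<longlongrightarrow> c k * 0) (at_right 0)" for k
        unfolding h_def by (intro tendsto_mult tendsto_const beta_primitive_at_0 bn assms)
    qed (auto simp: eventually_at_right_less)
    then show ?thesis by simp
  qed
  have H_top: "(H \<longlongrightarrow> (\<Sum>n. c n * (L * Beta (b + of_nat n + s) (y + s)))) at_top"
    unfolding H_def
  proof (rule tendsto_suminf_if_dominated[OF _ _ h_le sum_Bd])
    show "(h k \<longlongrightarrow> c k * (L * Beta (b + of_nat k + s) (y + s))) at_top" for k
      unfolding h_def by (intro tendsto_mult tendsto_const beta_primitive_at_top bn assms)
  qed (auto simp: eventually_gt_at_top)
  have dH: "(H has_vector_derivative of_real P powr (s - 1) * (\<Sum>n. c n * I n P)) (at P)" if P: "P > 0" for P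
  proof -
    \<comment> \<open>A neighbourhood of \<open>P\<close> whose closure is compact in the positive
      half-line, as the linear bound and the bound on \<open>Q powr (Re s - 1)\<close> are available
      on compact intervals only.\<close>
    define S where "S = {P / 2<..<2 * P}"
    have S: "open S" "convex S" "P \<in> S" using P by (auto simp: S_def)
    have pos: "Q > 0" if "Q \<in> S" for Q using that P by (auto simp: S_def)
    obtain K where K: "K \<ge> 0" "\<And>n Q. Q \<in> {P / 2..2 * P} \<Longrightarrow> norm (I n Q) \<le> K * (real n + 1)"
      using beta_integral_linear_bound[of b y "P / 2" "2 * P"] assms P unfolding I_def by auto
    have "compact ((\<lambda>Q. Q powr (Re s - 1)) ` {P / 2..2 * P})"
      using P by (intro compact_continuous_image continuous_intros) auto
    then obtain C where C: "\<And>Q. Q \<in> {P / 2..2 * P} \<Longrightarrow> norm (Q powr (Re s - 1)) \<le> C"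
      by (meson bounded_iff compact_imp_bounded imageI)
    have d_le: "norm (d n Q) \<le> norm (c n) * (real n + 1) * (C * K)" if "Q \<in> S" for n Q
    proof -
      have Q: "Q \<in> {P / 2..2 * P}" using that by (auto simp: S_def)
      have "Q powr (Re s - 1) * norm (I n Q) \<le> C * (K * (real n + 1))"
        using K(2)[OF Q, of n] C[OF Q] order_trans[OF norm_ge_zero C[OF Q]] by (intro mult_mono) auto
      from mult_left_mono[OF this norm_ge_zero[of "c n"]] show ?thesis
        using pos[OF that] by (simp add: d_def norm_mult norm_of_real_powr mult_ac)
    qed
    have "uniform_limit S (\<lambda>n Q. \<Sum>i<n. d i Q) (\<lambda>Q. \<Sum>i. d i Q) sequentially"
      by (rule Weierstrass_m_test[OF d_le summable_mult2[OF c]])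
    note uniform = uniform_limitD[OF this]
    have "\<exists>g. \<forall>Q\<in>S. (\<lambda>n. h n Q) sums g Q \<and> (g has_derivative (\<lambda>k. k *\<^sub>R (\<Sum>i. d i Q))) (at Q within S)"
    proof (rule has_derivative_series[OF S(2) _ _ S(3)])
      fix n Q assume Q: "Q \<in> S"
      have "(h n has_vector_derivative d n Q) (at Q)"
        unfolding h_def d_def I_def
        by (intro has_vector_derivative_mult_right beta_primitive_has_vector_derivative bn assms pos Q)
      then show "(h n has_derivative (\<lambda>k. k *\<^sub>R d n Q)) (at Q within S)"
        by (simp add: has_vector_derivative_def has_derivative_at_withinI)
    next
      fix r :: real assume "r > 0"
      from uniform[OF this]
      show "eventually (\<lambda>n. \<forall>Q\<in>S. \<forall>k. norm ((\<Sum>i<n. k *\<^sub>R d i Q) - k *\<^sub>R (\<Sum>i. d i Q)) \<le> r * norm k) sequentially"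
      proof eventually_elim
        case (elim n)
        show ?case
        proof (intro ballI allI)
          fix Q k assume "Q \<in> S"
          then have "norm ((\<Sum>i<n. d i Q) - (\<Sum>i. d i Q)) \<le> r"
            using elim by (auto simp: dist_norm less_imp_le)
          then show "norm ((\<Sum>i<n. k *\<^sub>R d i Q) - k *\<^sub>R (\<Sum>i. d i Q)) \<le> r * norm k"
            by (simp add: mult.commute[of r] mult_left_mono flip: scaleR_sum_right scaleR_diff_right)
        qed
      qed
    next
      show "(\<lambda>n. h n P) sums H P"
        unfolding H_def by (intro summable_sums summable_comparison_test'[OF sum_Bd h_le[OF P]])
    qed
    then obtain g where g: "\<And>Q. Q \<in> S \<Longrightarrow> (\<lambda>n. h n Q) sums g Q"
      "\<And>Q. Q \<in> S \<Longrightarrow> (g has_derivative (\<lambda>k. k *\<^sub>R (\<Sum>i. d i Q))) (at Q within S)" by blast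
    have eq: "g Q = H Q" if "Q \<in> S" for Q
      unfolding H_def using sums_unique[OF g(1)[OF that]] .
    have "(g has_vector_derivative (\<Sum>i. d i P)) (at P)"
      using g(2)[OF S(3)] by (simp add: has_vector_derivative_def at_within_open[OF S(3,1)])
    then have "(H has_vector_derivative (\<Sum>i. d i P)) (at P)"
      using has_vector_derivative_transform_within_open[OF _ S(1,3) eq] by simp
    moreover have "(\<Sum>i. d i P) = of_real P powr (s - 1) * (\<Sum>n. c n * I n P)"
    proof -
      have "summable (\<lambda>n. c n * I n P)"
      proof (rule summable_comparison_test'[OF summable_mult2[OF c, of K]])
        show "norm (c n * I n P) \<le> norm (c n) * (real n + 1) * K" if "n \<ge> 0" for n
          using mult_left_mono[OF K(2)[of P n] norm_ge_zero[of "c n"]] P by (simp add: norm_mult mult_ac)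
      qed
      from suminf_mult[OF this, of "of_real P powr (s - 1)"] show ?thesis
        by (simp add: d_def mult_ac)
    qed
    ultimately show ?thesis by simp
  qed
  \<comment> \<open>\<open>H\<close> is controlled for positive arguments only; \<open>J\<close>
    extends it by its right-hand limit \<open>0\<close>, which makes it continuous on
    \<open>{0..P}\<close>.\<close>
  define J where "J = (\<lambda>P. if P \<le> 0 then 0 else H P)"
  have dJ: "(J has_vector_derivative of_real P powr (s - 1) * (\<Sum>n. c n * I n P)) (at P)" if "P > 0" for P
    using that by (intro has_vector_derivative_transform_within_open[OF dH, of P "{0<..}"]) (auto simp: J_def)
  have "((\<lambda>p. of_real p powr (s - 1) * (\<Sum>n. c n * I n p)) has_integral
      (\<Sum>n. c n * (L * Beta (b + of_nat n + s) (y + s)))) {0..}"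
  proof (rule has_integral_Ici_if_tendsto[OF _ H_top])
    fix P :: real assume P: "P > 0"
    have "((\<lambda>p. of_real p powr (s - 1) * (\<Sum>n. c n * I n p)) has_integral J P - J 0) {0..P}"
    proof (rule fundamental_theorem_of_calculus_interior)
      show "continuous_on {0..P} J"
        unfolding continuous_on_eq_continuous_within
      proof
        fix t assume t: "t \<in> {0..P}"
        show "continuous (at t within {0..P}) J"
        proof (cases "t = 0")
          case True
          have "eventually (\<lambda>t. H t = J t) (at_right 0)"
            by (auto simp: J_def eventually_at_filter)
          then have "(J \<longlongrightarrow> 0) (at_right 0)"
            using Lim_transform_eventually[OF H0] by blast
          then show ?thesis
            using True P by (simp add: continuous_within at_within_Icc_at_right J_def)
        next
          case False
          then have "isCont J t" using t by (intro has_vector_derivative_continuous[OF dJ]) auto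
          then show ?thesis by (rule continuous_at_imp_continuous_at_within)
        qed
      qed
    qed (use P dJ in auto)
    then show "((\<lambda>p. of_real p powr (s - 1) * (\<Sum>n. c n * I n p)) has_integral H P) {0..P}"
      using P by (simp add: J_def)
  qed
  then show ?thesis unfolding I_def .
qed

end

section \<open>Coefficients of the hypergeometric series\<close>

text \<open>Ratio test: the ratio tends to \<open>norm z\<close>, since the weight
  \<open>real n + 1\<close>, which pays for the linear growth, changes it only by
  \<open>(n + 2) / (n + 1)\<close>.\<close>

lemma summable_pochhammer_power:
  fixes a z :: complex
  assumes "norm z < 1"
  shows "summable (\<lambda>n. norm (pochhammer a n * z ^ n / fact n) * (real n + 1))"
proof -
  let ?f = "\<lambda>n. norm (pochhammer a n * z ^ n / fact n) * (real n + 1)"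
  obtain r where r: "norm z < r" "r < 1" using assms dense by blast
  have "(\<lambda>n. (norm a + real n) / (real n + 1) * ((real n + 2) / (real n + 1)) * norm z) \<longlonglongrightarrow> norm z"
    by real_asymp
  then have "eventually (\<lambda>n. (norm a + real n) / (real n + 1) * ((real n + 2) / (real n + 1)) * norm z < r) sequentially"
    using r by (intro order_tendstoD)
  then obtain N where N: "\<And>n. n \<ge> N \<Longrightarrow>
    (norm a + real n) / (real n + 1) * ((real n + 2) / (real n + 1)) * norm z < r"
    by (auto simp: eventually_sequentially)
  show ?thesis
  proof (rule summable_ratio_test[OF r(2), of N])
    fix n assume n: "n \<ge> N"
    have Suc: "norm (1 + complex_of_nat n) = real n + 1"
      using norm_of_nat[of "Suc n", where ?'a = complex] by (simp add: add_ac)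
    then have "1 + complex_of_nat n \<noteq> 0" by (metis add_pos_nonneg norm_zero of_nat_0_le_iff order_less_irrefl zero_less_one add.commute)
    then have "norm (?f (Suc n)) = ?f n * (norm (a + of_nat n) / (real n + 1) * ((real n + 2) / (real n + 1)) * norm z)"
      by (simp add: pochhammer_Suc norm_mult norm_divide divide_simps Suc)
    also have "\<dots> \<le> ?f n * ((norm a + real n) / (real n + 1) * ((real n + 2) / (real n + 1)) * norm z)"
      using norm_triangle_ineq[of a "of_nat n"] 
      by (intro mult_left_mono mult_right_mono divide_right_mono) auto
    also have "\<dots> \<le> ?f n * r"
      using N[OF n] by (intro mult_left_mono) auto
    finally show "norm (?f (Suc n)) \<le> r * norm (?f n)"
      by (simp add: mult.commute)
  qed
qed

text \<open>Turns the Beta values produced by the termwise Mellin transform into coefficients of the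
  Gauss series.\<close>

lemma Beta_add_of_nat:
  assumes "Re x > 0" "Re y > 0"
  shows "Beta (x + of_nat n) y = Beta x y * (pochhammer x n / pochhammer (x + y) n)"
proof -
  have np: "x \<notin> \<int>\<^sub>\<le>\<^sub>0" "x + y \<notin> \<int>\<^sub>\<le>\<^sub>0" using assms by (auto intro!: not_nonpos_Ints_if_Re_pos)
  then have "pochhammer x n = Gamma (x + of_nat n) / Gamma x"
    "pochhammer (x + y) n = Gamma (x + y + of_nat n) / Gamma (x + y)"
    by (auto intro!: pochhammer_Gamma)
  moreover have "Gamma x \<noteq> 0" "Gamma (x + y) \<noteq> 0" using np by (auto simp: Gamma_eq_zero_iff)
  ultimately show ?thesis
    by (simp add: Beta_def add_ac)
qed

text \<open>Integrability is part of the conclusion because \<open>integral\<close> returns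
  \<open>0\<close> on functions that are not integrable; the equation alone would not show that the
  Mellin transform exists.\<close>

theorem theorem3p5:
  fixes \<alpha> \<beta> \<gamma> a b c z s :: complex
  assumes "Re \<alpha> > 0"
    and "Re c > Re b" and "Re b > 0"
    and "Re s > 0"
    and "norm z < 1"
    and Gamma_integral_converges:
      "(\<lambda>u. of_real u powr (s - 1) * mittag_leffler \<alpha> \<beta> \<gamma> (of_real (- u))) integrable_on {0..}"
  shows "(\<lambda>p. of_real p powr (s - 1) * mittag_leffler_hypergeom \<alpha> \<beta> \<gamma> p a b c z) integrable_on {0..} \<and>
         mellin (\<lambda>p. mittag_leffler_hypergeom \<alpha> \<beta> \<gamma> p a b c z) s =
           mittag_leffler_Gamma \<alpha> \<beta> \<gamma> s * Beta (b + s) (c + s - b) / Beta b (c - b) *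
           gauss_hypergeom a (b + s) (c + 2 * s) z"
proof -
  define e where "e = (\<lambda>u. mittag_leffler \<alpha> \<beta> \<gamma> (of_real (- u)))"
  define f where "f = (\<lambda>u. of_real u powr (s - 1) * e u)"
  define G where "G = (\<lambda>v. integral {0..v} f)"
  define L where "L = mittag_leffler_Gamma \<alpha> \<beta> \<gamma> s"
  have f: "(f has_integral L) {0..}"
    using Gamma_integral_converges unfolding f_def e_def L_def mittag_leffler_Gamma_def
    by (rule integrable_integral)
  have f_int: "f integrable_on {0..v}" for v
    by (rule integrable_on_subinterval[OF has_integral_integrable[OF f]]) auto
  have G_top: "(G \<longlongrightarrow> L) at_top"
    unfolding G_def using f by (rule tendsto_integral_at_top)
  have cont_e: "continuous_on A e" for A
    unfolding e_def
    by (rule continuous_on_compose2[OF continuous_on_mittag_leffler[OF assms(1)]])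
       (auto intro!: continuous_intros)
  have cont_f: "continuous_on {0<..} f"
    unfolding f_def by (intro continuous_intros cont_e) auto
  have cont_G: "continuous_on {0..v} G" for v
    unfolding G_def by (rule indefinite_integral_continuous_1[OF f_int])
  have dG: "(G has_vector_derivative of_real v powr (s - 1) * e v) (at v)" if "v > 0" for v
  proof -
    have "continuous (at v) f"
      using that cont_f by (simp add: continuous_on_eq_continuous_at)
    \<comment> \<open>The interval extends to \<open>v + 1\<close> so that \<open>v\<close> is an
      interior point and the derivative becomes two-sided.\<close>
    then have "(G has_vector_derivative f v) (at v within {0..v + 1})"
      unfolding G_def using that
      integral_has_vector_derivative_continuous_at[OF f_int[of "v + 1"], of v "{}"]
      by (simp add: continuous_at_imp_continuous_at_within)
    then show ?thesis using that by (simp add: f_def at_within_Icc_at)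
  qed
  obtain M where M: "\<And>v. v > 0 \<Longrightarrow> norm (G v) \<le> M"
  proof -
    have "eventually (\<lambda>v. norm (G v) < norm L + 1) at_top"
      using tendsto_norm[OF G_top] by (rule order_tendstoD) simp
    then obtain B where B: "\<And>v. v \<ge> B \<Longrightarrow> norm (G v) < norm L + 1"
      by (auto simp: eventually_at_top_linorder)
    have "bounded (G ` {0..B})"
      by (intro compact_imp_bounded compact_continuous_image cont_G) auto
    then obtain C where C: "\<And>v. v \<in> {0..B} \<Longrightarrow> norm (G v) \<le> C"
      by (meson bounded_iff imageI)
    show ?thesis
    proof (rule that[of "max C (norm L + 1)"])
      fix v :: real assume "v > 0"
      then show "norm (G v) \<le> max C (norm L + 1)"
        using B[of v] C[of v] by (cases "v \<ge> B") auto
    qed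
  qed
  have "((\<lambda>v. G v) \<longlongrightarrow> G 0) (at 0 within {0..1})"
    using cont_G[of 1] by (simp add: continuous_on_def)
  then have G_0: "(G \<longlongrightarrow> 0) (at_right 0)"
    by (simp add: at_within_Icc_at_right G_def)
  interpret mellin_kernel e G s L M
    by unfold_locales (use assms cont_e dG M G_0 G_top in auto)
  define k where "k = (\<lambda>n. pochhammer a n * z ^ n / fact n / Beta b (c - b))"
  have "summable (\<lambda>n. norm (pochhammer a n * z ^ n / fact n) * (real n + 1) / norm (Beta b (c - b)))"
    by (intro summable_divide summable_pochhammer_power assms)
  then have "summable (\<lambda>n. norm (k n) * (real n + 1))"
    by (simp only: k_def norm_divide times_divide_eq_left)
  from mellin_series[OF assms(3) _ this, of "c - b"]
  have series: "((\<lambda>p. of_real p powr (s - 1) *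
            (\<Sum>n. k n * integral {0..1} (beta_integrand (b + of_nat n) (c - b) p)))
          has_integral (\<Sum>n. k n * (L * Beta (b + of_nat n + s) (c - b + s)))) {0..}"
    using assms by simp
  have F: "(\<Sum>n. k n * integral {0..1} (beta_integrand (b + of_nat n) (c - b) p)) =
      mittag_leffler_hypergeom \<alpha> \<beta> \<gamma> p a b c z" for p
  proof -
    have "mittag_leffler_Beta \<alpha> \<beta> \<gamma> p (b + of_nat n) (c - b) =
        integral {0..1} (beta_integrand (b + of_nat n) (c - b) p)" for n
      unfolding mittag_leffler_Beta_def beta_integrand_def[abs_def] beta_weight_def
      unfolding e_def ..
    then show ?thesis
      unfolding mittag_leffler_hypergeom_def k_def by (simp add: mult_ac)
  qed
  have Re_pos: "Re (b + s) > 0" "Re (c - b + s) > 0" using assms by auto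
  have Beta_n: "Beta (b + of_nat n + s) (c - b + s) =
      Beta (b + s) (c + s - b) * (pochhammer (b + s) n / pochhammer (c + 2 * s) n)" for n
    using Beta_add_of_nat[OF Re_pos, of n] by (simp add: algebra_simps)
  have Beta_nz: "Beta (b + s) (c + s - b) \<noteq> 0"
    using Re_pos not_nonpos_Ints_if_Re_pos[of "b + s"] not_nonpos_Ints_if_Re_pos[of "c - b + s"]
      not_nonpos_Ints_if_Re_pos[of "b + s + (c - b + s)"]
    by (simp add: Beta_def Gamma_eq_zero_iff algebra_simps)
  define g where "g = (\<lambda>n. pochhammer a n * pochhammer (b + s) n / pochhammer (c + 2 * s) n * z ^ n / fact n)"
  \<comment> \<open>Pulling the constant out of the Gauss series requires its summability. The
    quotient of Pochhammer symbols is a quotient of Beta values, and \<open>B\<close> bounds it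
    uniformly in \<open>n\<close>.\<close>
  define B where "B = Beta (Re (b + s)) (Re (c - b + s)) / norm (Beta (b + s) (c + s - b))"
  have "norm (g n) \<le> norm (pochhammer a n * z ^ n / fact n) * (real n + 1) * B" for n
  proof -
    have "pochhammer (b + s) n / pochhammer (c + 2 * s) n =
        Beta (b + s + of_nat n) (c - b + s) / Beta (b + s) (c + s - b)"
      using Beta_n[of n] Beta_nz by (simp add: add_ac)
    moreover have "g n = pochhammer a n * z ^ n / fact n * (pochhammer (b + s) n / pochhammer (c + 2 * s) n)"
      by (simp add: g_def mult_ac)
    ultimately have gn: "g n = pochhammer a n * z ^ n / fact n *
        (Beta (b + s + of_nat n) (c - b + s) / Beta (b + s) (c + s - b))"
      by (simp only:)
    have "norm (Beta (b + s + of_nat n) (c - b + s)) \<le> Beta (Re (b + s + of_nat n)) (Re (c - b + s))"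
      using Re_pos by (intro norm_Beta_le) auto
    also have "\<dots> \<le> Beta (Re (b + s)) (Re (c - b + s))"
      using Re_pos by (intro Beta_real_mono) auto
    finally have "norm (Beta (b + s + of_nat n) (c - b + s) / Beta (b + s) (c + s - b)) \<le> B"
      unfolding B_def norm_divide by (intro divide_right_mono) auto
    moreover have "norm (pochhammer a n * z ^ n / fact n) * 1 \<le> norm (pochhammer a n * z ^ n / fact n) * (real n + 1)"
      by (intro mult_left_mono) auto
    ultimately show ?thesis
      unfolding gn norm_mult[of "pochhammer a n * z ^ n / fact n" "Beta _ _ / _"] by (intro mult_mono) auto
  qed
  then have "summable g"
    by (intro summable_comparison_test'[OF summable_mult2[OF summable_pochhammer_power[OF assms(5)]]])
  then have "(\<Sum>n. L * Beta (b + s) (c + s - b) / Beta b (c - b) * g n) =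
      L * Beta (b + s) (c + s - b) / Beta b (c - b) * gauss_hypergeom a (b + s) (c + 2 * s) z"
    unfolding gauss_hypergeom_def g_def by (rule suminf_mult)
  moreover have "k n * (L * Beta (b + of_nat n + s) (c - b + s)) =
      L * Beta (b + s) (c + s - b) / Beta b (c - b) * g n" for n
    unfolding Beta_n k_def g_def by (simp add: mult_ac)
  ultimately show ?thesis
    using series unfolding F mellin_def L_def by (simp add: has_integral_iff)
qed

end
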